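(* Let $P,P_1$ be non-commutative Poisson algebras over $K$ such that the associative algebras $(P,\cdot)$ and $(P_1,\cdot)$ are both domains. Let $\phi:P\to P_1$ be an injective Poisson homomorphism and assume $GK(P_1)<GK(P)+1<\infty$. Then: (1) $\phi(\Omega_0(P))\subseteq \Omega_0(P_1)\cup\Omega_0'(P_1)$. (2) $\phi(\Omega_1(P))\subseteq \Omega_1(P_1)\cup\Omega_1'(P_1)$. (3) $\phi(\Omega_2(P))\subseteq \Omega_2(P_1)\cup\Omega_2'(P_1)$. (4) $\phi(\Omega_3(P))\subseteq \Omega_3(P_1)\cup\Omega_3'(P_1)$. (5) $\phi(\Omega_3'(P))\subseteq \Omega_3'(P_1)$. (6) $\phi(\Omega'(P))\subseteq \Omega'(P_1)$, i.e. $\phi(\Omega'(P))\cap\Omega(P_1)=\emptyset$. Assume in addition that $z\in P$ satisfies $GK(F(z,P))=GK(P)$, where $F(z,P)$ is the torsion algebra of $z$ in $P$. Then: (7) If $z\in\Omega_1'(P)$, then $\phi(z)\in\Omega_1'(P_1)$. (8) If $z\in\Omega_2'(P)$, then $\phi(z)\in\Omega_2'(P_1)$.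
   Context: $K$ is an algebraically closed field of characteristic zero. A non-commutative Poisson algebra over $K$ is a $K$-vector space $P$ with a bilinear product $\cdot$ making it a unital associative (not necessarily commutative) $K$-algebra and a bilinear bracket $\{\cdot,\cdot\}$ making it a Lie algebra, such that $\{x,yz\}=\{x,y\}z+y\{x,z\}$ for all $x,y,z\in P$. A Poisson homomorphism is a $K$-linear map that is a homomorphism of associative algebras and of Lie algebras. $GK(\cdot)$ denotes the Gelfand–Kirillov dimension over $K$ of the underlying associative algebra $(P,\cdot)$. For $z\in P$ put $ad_z(w)=\{z,w\}$ and $Ev(z)=\{\lambda\in K\mid \exists x\in P\setminus\{0\},\ ad_z(x)=\lambda x\}$, $F(z)=F(z,P)=\{x\in P\mid \dim_K K[ad_z](x)<\infty\}$ (the torsion algebra of $z$), $N(z)=\{x\in P\mid \exists m,\ ad_z^m(x)=0\}$, $C(z)=\{x\in P\mid ad_z(x)=0\}$, $D(z)=\bigoplus_{\lambda\in Ev(z)}D(z,\lambda)$ with $D(z,\lambda)=\{x\in P\mid ad_z(x)=\lambda x\}$. These are subalgebras of $P$. Types of elements. If $Ev(z)=\{0\}$: $z\in\Omega_0(P)$ if $C(z)=P$; $z\in\Omega_0'(P)$ if $C(z)=F(z)\subsetneq P$; $z\in\Omega_1(P)$ if $C(z)\subsetneq N(z)=P$; $z\in\Omega_1'(P)$ if $C(z)\subsetneq N(z)\subsetneq P$. If $Ev(z)\supsetneq\{0\}$: $z\in\Omega_2(P)$ if $D(z)=F(z)=P$; $z\in\Omega_2'(P)$ if $D(z)=F(z)\subsetneq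 P$; $z\in\Omega_3(P)$ if $D(z)\subsetneq F(z)=P$; $z\in\Omega_3'(P)$ if $D(z)\subsetneq F(z)\subsetneq P$. $\Omega(P)=\bigcup_{i=0}^3\Omega_i(P)$ and $\Omega'(P)=\bigcup_{i=0}^3\Omega_i'(P)$. *)

theory Defs
  imports "HOL-Library.Extended_Real" "HOL-Computational_Algebra.Polynomial"
begin

text \<open>
  Algebras are modelled on whole types: \<^typ>\<open>'a\<close> carries the unital associative product, \<open>s\<close> is
  the scalar multiplication by the field and \<open>b x y\<close> is the bracket of \<open>x\<close> and \<open>y\<close>, so that
  \<open>b z\<close> is the operator \<open>ad z\<close>.
\<close>

locale nc_poisson_algebra = vector_space s
  for s :: "'k::field \<Rightarrow> 'a::ring_1 \<Rightarrow> 'a" +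
  fixes b :: "'a \<Rightarrow> 'a \<Rightarrow> 'a"
  assumes scale_mult_left: "s c x * y = s c (x * y)"
    and scale_mult_right: "x * s c y = s c (x * y)"
    and bracket_add_left: "b (x + y) w = b x w + b y w"
    and bracket_add_right: "b w (x + y) = b w x + b w y"
    and bracket_scale_left: "b (s c x) y = s c (b x y)"
    and bracket_scale_right: "b x (s c y) = s c (b x y)"
    and bracket_self: "b x x = 0"
    and jacobi: "b x (b y w) + b y (b w x) + b w (b x y) = 0"
    and leibniz: "b x (y * w) = b x y * w + y * b x w"

definition poisson_hom ::
  "('k::field \<Rightarrow> 'a::ring_1 \<Rightarrow> 'a) \<Rightarrow> ('a \<Rightarrow> 'a \<Rightarrow> 'a) \<Rightarrow>
   ('k \<Rightarrow> 'c::ring_1 \<Rightarrow> 'c) \<Rightarrow> ('c \<Rightarrow> 'c \<Rightarrow> 'c) \<Rightarrow> ('a \<Rightarrow> 'c) \<Rightarrow> bool" where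
  "poisson_hom s b s1 b1 f \<longleftrightarrow>
     Vector_Spaces.linear s s1 f \<and> f 1 = 1 \<and>
     (\<forall>x y. f (x * y) = f x * f y) \<and> (\<forall>x y. f (b x y) = b1 (f x) (f y))"

definition fin_dim_subspace :: "('k::field \<Rightarrow> 'a::ab_group_add \<Rightarrow> 'a) \<Rightarrow> 'a set \<Rightarrow> bool" where
  "fin_dim_subspace s V \<longleftrightarrow> (\<exists>B. finite B \<and> V = module.span s B)"


subsection \<open>Gelfand--Kirillov dimension\<close>

primrec subspace_power :: "('k::field \<Rightarrow> 'a::ring_1 \<Rightarrow> 'a) \<Rightarrow> 'a set \<Rightarrow> nat \<Rightarrow> 'a set" where
  "subspace_power s V 0 = module.span s {1}"
| "subspace_power s V (Suc n) = module.span s {x * y | x y. x \<in> subspace_power s V n \<and> y \<in> V}"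

definition filtration :: "('k::field \<Rightarrow> 'a::ring_1 \<Rightarrow> 'a) \<Rightarrow> 'a set \<Rightarrow> nat \<Rightarrow> 'a set" where
  "filtration s V n = module.span s (\<Union>i\<le>n. subspace_power s V i)"

text \<open>
  The dimension of a unital subalgebra \<open>A\<close> of the ambient algebra; the whole algebra is
  \<open>A = UNIV\<close>.  The filtration pieces are finite-dimensional and contain \<open>1\<close>, so
  \<^const>\<open>vector_space.dim\<close>, which is a natural number, is their genuine positive dimension.
\<close>

definition GKdim :: "('k::field \<Rightarrow> 'a::ring_1 \<Rightarrow> 'a) \<Rightarrow> 'a set \<Rightarrow> ereal" where
  "GKdim s A =
     (SUP V\<in>{V. fin_dim_subspace s V \<and> V \<subseteq> A}.
        limsup (\<lambda>n. ereal (log (real n) (real (vector_space.dim s (filtration s V n))))))"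


subsection \<open>Subalgebras attached to an element\<close>

definition Ev :: "('k::field \<Rightarrow> 'a::ring_1 \<Rightarrow> 'a) \<Rightarrow> ('a \<Rightarrow> 'a \<Rightarrow> 'a) \<Rightarrow> 'a \<Rightarrow> 'k set" where
  "Ev s b z = {l. \<exists>x. x \<noteq> 0 \<and> b z x = s l x}"

text \<open>\<open>cyclic_subspace s f x\<close> is \<open>K[f](x)\<close>, the set of all \<open>p(f)(x)\<close> for polynomials \<open>p\<close>.\<close>

definition cyclic_subspace ::
  "('k::field \<Rightarrow> 'a::ab_group_add \<Rightarrow> 'a) \<Rightarrow> ('a \<Rightarrow> 'a) \<Rightarrow> 'a \<Rightarrow> 'a set" where
  "cyclic_subspace s f x = {\<Sum>i\<le>degree p. s (coeff p i) ((f ^^ i) x) | p. True}"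

definition torsion_alg ::
  "('k::field \<Rightarrow> 'a::ring_1 \<Rightarrow> 'a) \<Rightarrow> ('a \<Rightarrow> 'a \<Rightarrow> 'a) \<Rightarrow> 'a \<Rightarrow> 'a set" where
  "torsion_alg s b z = {x. fin_dim_subspace s (cyclic_subspace s (b z) x)}"

definition nil_alg :: "('a::ring_1 \<Rightarrow> 'a \<Rightarrow> 'a) \<Rightarrow> 'a \<Rightarrow> 'a set" where
  "nil_alg b z = {x. \<exists>m. (b z ^^ m) x = 0}"

definition centralizer :: "('a::ring_1 \<Rightarrow> 'a \<Rightarrow> 'a) \<Rightarrow> 'a \<Rightarrow> 'a set" where
  "centralizer b z = {x. b z x = 0}"

definition eigenspace ::
  "('k::field \<Rightarrow> 'a::ring_1 \<Rightarrow> 'a) \<Rightarrow> ('a \<Rightarrow> 'a \<Rightarrow> 'a) \<Rightarrow> 'a \<Rightarrow> 'k \<Rightarrow> 'a set" where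
  "eigenspace s b z l = {x. b z x = s l x}"

text \<open>The internal sum of the eigenspaces, which is direct because the eigenvalues are distinct.\<close>

definition eigen_alg ::
  "('k::field \<Rightarrow> 'a::ring_1 \<Rightarrow> 'a) \<Rightarrow> ('a \<Rightarrow> 'a \<Rightarrow> 'a) \<Rightarrow> 'a \<Rightarrow> 'a set" where
  "eigen_alg s b z = module.span s (\<Union>l\<in>Ev s b z. eigenspace s b z l)"


subsection \<open>Types of elements\<close>

definition Omega0 :: "('k::field \<Rightarrow> 'a::ring_1 \<Rightarrow> 'a) \<Rightarrow> ('a \<Rightarrow> 'a \<Rightarrow> 'a) \<Rightarrow> 'a set" where
  "Omega0 s b = {z. Ev s b z = {0} \<and> centralizer b z = UNIV}"

definition Omega0' :: "('k::field \<Rightarrow> 'a::ring_1 \<Rightarrow> 'a) \<Rightarrow> ('a \<Rightarrow> 'a \<Rightarrow> 'a) \<Rightarrow> 'a set" where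
  "Omega0' s b =
     {z. Ev s b z = {0} \<and> centralizer b z = torsion_alg s b z \<and> torsion_alg s b z \<subset> UNIV}"

definition Omega1 :: "('k::field \<Rightarrow> 'a::ring_1 \<Rightarrow> 'a) \<Rightarrow> ('a \<Rightarrow> 'a \<Rightarrow> 'a) \<Rightarrow> 'a set" where
  "Omega1 s b = {z. Ev s b z = {0} \<and> centralizer b z \<subset> nil_alg b z \<and> nil_alg b z = UNIV}"

definition Omega1' :: "('k::field \<Rightarrow> 'a::ring_1 \<Rightarrow> 'a) \<Rightarrow> ('a \<Rightarrow> 'a \<Rightarrow> 'a) \<Rightarrow> 'a set" where
  "Omega1' s b = {z. Ev s b z = {0} \<and> centralizer b z \<subset> nil_alg b z \<and> nil_alg b z \<subset> UNIV}"

definition Omega2 :: "('k::field \<Rightarrow> 'a::ring_1 \<Rightarrow> 'a) \<Rightarrow> ('a \<Rightarrow> 'a \<Rightarrow> 'a) \<Rightarrow> 'a set" where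
  "Omega2 s b =
     {z. {0} \<subset> Ev s b z \<and> eigen_alg s b z = torsion_alg s b z \<and> torsion_alg s b z = UNIV}"

definition Omega2' :: "('k::field \<Rightarrow> 'a::ring_1 \<Rightarrow> 'a) \<Rightarrow> ('a \<Rightarrow> 'a \<Rightarrow> 'a) \<Rightarrow> 'a set" where
  "Omega2' s b =
     {z. {0} \<subset> Ev s b z \<and> eigen_alg s b z = torsion_alg s b z \<and> torsion_alg s b z \<subset> UNIV}"

definition Omega3 :: "('k::field \<Rightarrow> 'a::ring_1 \<Rightarrow> 'a) \<Rightarrow> ('a \<Rightarrow> 'a \<Rightarrow> 'a) \<Rightarrow> 'a set" where
  "Omega3 s b =
     {z. {0} \<subset> Ev s b z \<and> eigen_alg s b z \<subset> torsion_alg s b z \<and> torsion_alg s b z = UNIV}"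

definition Omega3' :: "('k::field \<Rightarrow> 'a::ring_1 \<Rightarrow> 'a) \<Rightarrow> ('a \<Rightarrow> 'a \<Rightarrow> 'a) \<Rightarrow> 'a set" where
  "Omega3' s b =
     {z. {0} \<subset> Ev s b z \<and> eigen_alg s b z \<subset> torsion_alg s b z \<and> torsion_alg s b z \<subset> UNIV}"

definition Omega :: "('k::field \<Rightarrow> 'a::ring_1 \<Rightarrow> 'a) \<Rightarrow> ('a \<Rightarrow> 'a \<Rightarrow> 'a) \<Rightarrow> 'a set" where
  "Omega s b = Omega0 s b \<union> Omega1 s b \<union> Omega2 s b \<union> Omega3 s b"

definition Omega' :: "('k::field \<Rightarrow> 'a::ring_1 \<Rightarrow> 'a) \<Rightarrow> ('a \<Rightarrow> 'a \<Rightarrow> 'a) \<Rightarrow> 'a set" where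
  "Omega' s b = Omega0' s b \<union> Omega1' s b \<union> Omega2' s b \<union> Omega3' s b"

end

theory Submission
  imports Defs "HOL-Analysis.Extended_Real_Limits"
begin

text \<open>
  The type of \<open>z\<close> is decided by three conditions: whether \<open>Ev z = {0}\<close>, whether
  \<open>D z = F z\<close> (equivalently, \<open>ad z\<close> has no Jordan block of size two), and whether \<open>F z\<close> is
  everything. Failure of any of them passes from \<open>z\<close> to \<open>\<phi> z\<close>. If one of the first
  two holds for \<open>z\<close> but not for \<open>\<phi> z\<close>, then there is a witness \<open>y\<close> in the larger algebra: an eigenvector for a
  nonzero eigenvalue, or a generalized eigenvector of height two. The powers of \<open>y\<close> are
  left linearly independent over \<open>\<phi>(N z)\<close>, respectively over \<open>\<phi>(D z)\<close>: compare generalized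
  eigencomponents and use that the algebra is a domain of characteristic zero. When that subalgebra
  is \<open>\<phi>(F z)\<close> and \<open>F z\<close> has full Gelfand--Kirillov dimension, the target has dimension at
  least one more than the source, which is excluded.
\<close>

section \<open>Generalized eigenspaces of \<open>ad z\<close>\<close>

context nc_poisson_algebra
begin

lemma bracket_zero_right [simp]: "b z 0 = 0"
  using bracket_add_right[of z 0 0] by simp

lemma bracket_one_right [simp]: "b z 1 = 0"
  using leibniz[of z 1 1] by simp

lemma bracket_diff_right: "b z (x - y) = b z x - b z y"
  using bracket_add_right[of z "x - y" y] by (simp add: algebra_simps)

definition shifted :: "'a \<Rightarrow> 'k \<Rightarrow> 'a \<Rightarrow> 'a" where
  "shifted z l x = b z x - s l x"

definition gen_eigenspace :: "'a \<Rightarrow> 'k \<Rightarrow> 'a set" where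
  "gen_eigenspace z l = {x. \<exists>m. (shifted z l ^^ m) x = 0}"

lemma shifted_zero [simp]: "shifted z 0 = b z"
  by (simp add: fun_eq_iff shifted_def)

lemma nil_alg_eq: "nil_alg b z = gen_eigenspace z 0"
  by (simp add: nil_alg_def gen_eigenspace_def)

lemma eigenspace_iff: "x \<in> eigenspace s b z l \<longleftrightarrow> shifted z l x = 0"
  by (simp add: eigenspace_def shifted_def)

lemma eigenspace_subset_gen: "eigenspace s b z l \<subseteq> gen_eigenspace z l"
proof
  fix x assume "x \<in> eigenspace s b z l"
  then have "(shifted z l ^^ 1) x = 0" by (simp add: eigenspace_iff)
  then show "x \<in> gen_eigenspace z l" unfolding gen_eigenspace_def by blast
qed

lemma shifted_0 [simp]: "shifted z l 0 = 0"
  by (simp add: shifted_def)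

lemma shifted_funpow_0 [simp]: "(shifted z l ^^ m) 0 = 0"
  by (induction m) auto

lemma shifted_add: "shifted z l (x + y) = shifted z l x + shifted z l y"
  by (simp add: shifted_def bracket_add_right scale_right_distrib)

lemma shifted_scale: "shifted z l (s c x) = s c (shifted z l x)"
  by (simp add: shifted_def bracket_scale_right scale_right_diff_distrib mult.commute)

lemma shifted_funpow_add:
  "(shifted z l ^^ m) (x + y) = (shifted z l ^^ m) x + (shifted z l ^^ m) y"
  by (induction m) (auto simp: shifted_add)

lemma shifted_funpow_scale: "(shifted z l ^^ m) (s c x) = s c ((shifted z l ^^ m) x)"
  by (induction m) (auto simp: shifted_scale)

lemma shifted_funpow_sum:
  "(shifted z l ^^ m) (\<Sum>i\<in>I. f i) = (\<Sum>i\<in>I. (shifted z l ^^ m) (f i))"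
  by (induction I rule: infinite_finite_induct) (auto simp: shifted_funpow_add)

lemma shifted_commute: "shifted z l (shifted z k x) = shifted z k (shifted z l x)"
  by (simp add: shifted_def bracket_diff_right bracket_scale_right scale_right_diff_distrib
      mult.commute)

lemma shifted_funpow_commute:
  "(shifted z l ^^ m) ((shifted z k ^^ n) x) = (shifted z k ^^ n) ((shifted z l ^^ m) x)"
proof -
  have 1: "(shifted z l ^^ m) (shifted z k x) = shifted z k ((shifted z l ^^ m) x)" for x
    by (induction m) (auto simp: shifted_commute)
  show ?thesis by (induction n) (auto simp: 1)
qed

text \<open>A Leibniz rule that splits the shift \<open>l + k\<close> between the two factors. It is
  the reason why eigenvalues add when elements are multiplied.\<close>

lemma shifted_mult: "shifted z (l + k) (x * y) = shifted z l x * y + x * shifted z k y"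
  by (simp add: shifted_def leibniz algebra_simps scale_left_distrib scale_mult_left
      scale_mult_right)

lemma shifted_funpow_mono:
  assumes "(shifted z l ^^ m) x = 0" "m \<le> n"
  shows "(shifted z l ^^ n) x = 0"
proof -
  have "(shifted z l ^^ n) x = (shifted z l ^^ (n - m)) ((shifted z l ^^ m) x)"
    using assms(2) funpow_add[of "n - m" m "shifted z l"] by simp
  then show ?thesis using assms(1) by simp
qed

lemma gen_eigenspace_funpow:
  assumes "x \<in> gen_eigenspace z l"
  shows "(shifted z k ^^ m) x \<in> gen_eigenspace z l"
proof -
  obtain n where "(shifted z l ^^ n) x = 0" using assms by (auto simp: gen_eigenspace_def)
  then have "(shifted z l ^^ n) ((shifted z k ^^ m) x) = 0"
    by (metis shifted_funpow_commute shifted_funpow_0)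
  then show ?thesis by (auto simp: gen_eigenspace_def)
qed

lemma subspace_gen_eigenspace: "subspace (gen_eigenspace z l)"
proof (rule subspaceI)
  show "0 \<in> gen_eigenspace z l" by (simp add: gen_eigenspace_def)
next
  fix x y assume "x \<in> gen_eigenspace z l" "y \<in> gen_eigenspace z l"
  then obtain m n where mn: "(shifted z l ^^ m) x = 0" "(shifted z l ^^ n) y = 0"
    by (auto simp: gen_eigenspace_def)
  then have "(shifted z l ^^ max m n) (x + y) = 0"
    using shifted_funpow_mono[of m z l x "max m n"] shifted_funpow_mono[of n z l y "max m n"]
    by (simp add: shifted_funpow_add)
  then show "x + y \<in> gen_eigenspace z l" by (auto simp: gen_eigenspace_def)
next
  fix c x assume "x \<in> gen_eigenspace z l"
  then show "s c x \<in> gen_eigenspace z l"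
    by (auto simp: gen_eigenspace_def shifted_funpow_scale)
qed

text \<open>Every application of the twisted Leibniz rule lowers the height of one of the two
  factors, so after \<open>m + n\<close> applications nothing is left. Hence the induction on the
  sum of the two exponents.\<close>

lemma gen_eigenspace_mult:
  assumes "x \<in> gen_eigenspace z l" "y \<in> gen_eigenspace z k"
  shows "x * y \<in> gen_eigenspace z (l + k)"
proof -
  obtain m n where "(shifted z l ^^ m) x = 0" "(shifted z k ^^ n) y = 0"
    using assms by (auto simp: gen_eigenspace_def)
  then have "(shifted z (l + k) ^^ (m + n)) (x * y) = 0"
  proof (induction "m + n" arbitrary: m n x y)
    case 0
    then show ?case by simp
  next
    case (Suc t)
    have "(shifted z (l + k) ^^ t) (shifted z l x * y) = 0"
    \<comment> \<open>A zero exponent says that the factor itself is zero, so this summand vanishes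
      without the induction hypothesis.\<close>
    proof (cases m)
      case 0
      then show ?thesis using Suc by simp
    next
      case m: (Suc m')
      show ?thesis using Suc(1)[of m' n "shifted z l x" y] Suc(2-) m
        by (simp add: funpow_swap1)
    qed
    moreover have "(shifted z (l + k) ^^ t) (x * shifted z k y) = 0"
    proof (cases n)
      case 0
      then show ?thesis using Suc by simp
    next
      case n: (Suc n')
      show ?thesis using Suc(1)[of m n' x "shifted z k y"] Suc(2-) n
        by (simp add: funpow_swap1)
    qed
    ultimately have "(shifted z (l + k) ^^ Suc t) (x * y) = 0"
      by (simp add: funpow_swap1 shifted_mult shifted_funpow_add)
    then show ?case using Suc(2) by simp
  qed
  then show ?thesis by (auto simp: gen_eigenspace_def)
qed

text \<open>On \<open>x\<close> the operator \<open>shifted z l\<close> is multiplication by the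
  nonzero scalar \<open>k - l\<close>, and no power of it kills a nonzero \<open>x\<close>.\<close>

lemma eigenspace_gen_eigenspace_disjoint:
  assumes "shifted z k x = 0" "x \<in> gen_eigenspace z l" "l \<noteq> k"
  shows "x = 0"
proof -
  obtain m where m: "(shifted z l ^^ m) x = 0" using assms(2) by (auto simp: gen_eigenspace_def)
  have 1: "shifted z l x = s (k - l) x"
    using assms(1) by (simp add: shifted_def scale_left_diff_distrib)
  have "(shifted z l ^^ m) x = s ((k - l) ^ m) x"
    by (induction m) (auto simp: shifted_scale 1 mult.commute)
  then show ?thesis using m assms(3) by simp
qed

text \<open>For \<open>l\<close> different from \<open>k\<close>, \<open>shifted z k\<close> maps
  \<open>gen_eigenspace z l\<close> to itself with trivial kernel, so all of its powers are
  injective there.\<close>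

lemma shifted_funpow_eq_0_imp:
  assumes "(shifted z k ^^ m) x = 0" "x \<in> gen_eigenspace z l" "l \<noteq> k"
  shows "x = 0"
  using assms(1,2)
proof (induction m arbitrary: x)
  case (Suc m)
  have "shifted z k x \<in> gen_eigenspace z l"
    using gen_eigenspace_funpow[OF Suc.prems(2), where m = 1 and k = k] by simp
  then have "shifted z k x = 0" using Suc.IH[of "shifted z k x"] Suc.prems(1)
    by (simp add: funpow_swap1)
  then show ?case using eigenspace_gen_eigenspace_disjoint Suc.prems(2) assms(3) by blast
qed simp

text \<open>A power of \<open>shifted z (k j)\<close> removes the summand at \<open>j\<close> and is
  injective on the others, which reduces the sum to a smaller index set. The eigenvalues are given
  by an injective \<open>k\<close> so that exponents of an element can serve as indices.\<close>

lemma gen_eigenspaces_independent: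
  assumes "finite I" "inj_on k I" "\<And>i. i \<in> I \<Longrightarrow> h i \<in> gen_eigenspace z (k i)"
    and "(\<Sum>i\<in>I. h i) = 0" "i \<in> I"
  shows "h i = 0"
  using assms
proof (induction I arbitrary: h i rule: finite_induct)
  case (insert j I)
  obtain m where m: "(shifted z (k j) ^^ m) (h j) = 0"
    using insert.prems(2)[of j] by (auto simp: gen_eigenspace_def)
  let ?T = "shifted z (k j) ^^ m"
  have "?T (\<Sum>i\<in>insert j I. h i) = 0" using insert.prems(3) by simp
  then have "(\<Sum>i\<in>I. ?T (h i)) = 0"
    using insert.hyps m by (simp add: shifted_funpow_sum shifted_funpow_add)
  then have "?T (h i) = 0" if "i \<in> I" for i
    using insert.IH[of "\<lambda>i. ?T (h i)" i] that insert.prems(1,2) gen_eigenspace_funpow by auto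
  then have 0: "h i = 0" if "i \<in> I" for i
  proof (rule shifted_funpow_eq_0_imp)
    show "k i \<noteq> k j" using insert.prems(1) insert.hyps that by (auto simp: inj_on_def)
  qed (use that insert.prems(2) in auto)
  moreover have "h j = 0" using insert.prems(3) insert.hyps 0 by simp
  ultimately show ?case using insert.prems(4) by auto
qed simp

section \<open>The subalgebra spanned by eigenvectors\<close>

lemma zero_in_Ev [simp]: "0 \<in> Ev s b z"
  unfolding Ev_def by (auto intro!: exI[of _ 1])

text \<open>\<open>g\<close> assigns a component to every scalar and vanishes off \<open>M\<close>;
  several decompositions can thus be summed over one larger index set. Scalars outside
  \<open>Ev s b z\<close> do no harm, their eigenspaces being zero.\<close>

lemma eigen_alg_iff:
  "x \<in> eigen_alg s b z \<longleftrightarrow>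
    (\<exists>M g. finite M \<and> (\<forall>l. g l \<in> eigenspace s b z l) \<and> (\<forall>l. l \<notin> M \<longrightarrow> g l = 0)
       \<and> x = (\<Sum>l\<in>M. g l))" (is "_ \<longleftrightarrow> ?R x")
proof
  assume "x \<in> eigen_alg s b z"
  then show "?R x" unfolding eigen_alg_def
  proof (induction rule: span_induct_alt)
    case base
    show ?case by (rule exI[of _ "{}"], rule exI[of _ "\<lambda>_. 0"]) (simp add: eigenspace_def)
  next
    case (step c x y)
    obtain l where l: "x \<in> eigenspace s b z l" using step(1) by auto
    obtain M g where g: "finite M" "\<And>l. g l \<in> eigenspace s b z l" "\<And>l. l \<notin> M \<Longrightarrow> g l = 0"
      "y = (\<Sum>l\<in>M. g l)" using step(2) by auto
    let ?g = "g(l := s c x + g l)"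
    have "(\<Sum>l\<in>M. g l) = (\<Sum>l\<in>insert l M. g l)"
      using g(1,3) by (intro sum.mono_neutral_left) auto
    also have "\<dots> = g l + (\<Sum>l\<in>M - {l}. g l)" using g(1) by (rule sum.insert_remove)
    finally have "s c x + y = ?g l + (\<Sum>l\<in>M - {l}. ?g l)" using g(4) by simp
    also have "\<dots> = (\<Sum>l\<in>insert l M. ?g l)" using g(1) by (rule sum.insert_remove[symmetric])
    finally have "s c x + y = (\<Sum>l\<in>insert l M. ?g l)" .
    moreover have "?g k \<in> eigenspace s b z k" for k
      using l g(2) by (auto simp: eigenspace_iff shifted_add shifted_scale)
    moreover have "?g k = 0" if "k \<notin> insert l M" for k using that g(3) by auto
    ultimately show ?case using g(1) by (intro exI[of _ "insert l M"] exI[of _ ?g]) blast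
  qed
next
  assume "?R x"
  then obtain M g where g: "finite M" "\<And>l. g l \<in> eigenspace s b z l" "x = (\<Sum>l\<in>M. g l)"
    by auto
  have "g l \<in> eigen_alg s b z" for l
  \<comment> \<open>Only a nonzero component shows that \<open>l\<close> is an eigenvalue.\<close>
  proof (cases "g l = 0")
    case True
    then show ?thesis by (simp add: eigen_alg_def span_zero)
  next
    case False
    then have "l \<in> Ev s b z" using g(2)[of l] by (auto simp: Ev_def eigenspace_def)
    then show ?thesis using g(2)[of l] unfolding eigen_alg_def by (intro span_base) blast
  qed
  then show "x \<in> eigen_alg s b z" unfolding g(3) eigen_alg_def by (intro span_sum) auto
qed

lemma eigenspace_subset_eigen_alg: "eigenspace s b z l \<subseteq> eigen_alg s b z"
proof
  fix x assume x: "x \<in> eigenspace s b z l"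
  show "x \<in> eigen_alg s b z"
    unfolding eigen_alg_iff
    using x by (intro exI[of _ "{l}"] exI[of _ "(\<lambda>_. 0)(l := x)"]) (auto simp: eigenspace_def)
qed

lemma subspace_eigen_alg: "subspace (eigen_alg s b z)"
  by (simp add: eigen_alg_def)

lemma eigenspace_mult:
  "x \<in> eigenspace s b z l \<Longrightarrow> y \<in> eigenspace s b z k \<Longrightarrow> x * y \<in> eigenspace s b z (l + k)"
  by (simp add: eigenspace_iff shifted_mult)

lemma eigen_alg_mult:
  assumes "x \<in> eigen_alg s b z" "y \<in> eigen_alg s b z"
  shows "x * y \<in> eigen_alg s b z"
proof -
  obtain M g where g: "\<And>l. g l \<in> eigenspace s b z l" "x = (\<Sum>l\<in>M. g l)"
    using assms(1) eigen_alg_iff by auto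
  obtain M' g' where g': "\<And>l. g' l \<in> eigenspace s b z l" "y = (\<Sum>l\<in>M'. g' l)"
    using assms(2) eigen_alg_iff by auto
  show ?thesis unfolding g(2) g'(2) sum_product
    using eigenspace_mult[OF g(1) g'(1)] eigenspace_subset_eigen_alg
    by (intro subspace_sum subspace_eigen_alg) blast
qed

lemma one_in_eigen_alg: "1 \<in> eigen_alg s b z"
  using eigenspace_subset_eigen_alg[of z 0] by (auto simp: eigenspace_def)

section \<open>The module over \<open>K[t]\<close> in which \<open>t\<close> acts as
  \<open>ad z\<close>, and its torsion\<close>

definition ad_poly :: "'a \<Rightarrow> 'k poly \<Rightarrow> 'a \<Rightarrow> 'a" where
  "ad_poly z p x = (\<Sum>i\<le>degree p. s (coeff p i) ((b z ^^ i) x))"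

lemma ad_poly_altdef:
  assumes "degree p \<le> n"
  shows "ad_poly z p x = (\<Sum>i\<le>n. s (coeff p i) ((b z ^^ i) x))"
  unfolding ad_poly_def using assms
  by (intro sum.mono_neutral_left) (auto simp: coeff_eq_0)

lemma ad_poly_add: "ad_poly z (p + q) x = ad_poly z p x + ad_poly z q x"
proof -
  let ?n = "max (degree p) (degree q)"
  have "degree (p + q) \<le> ?n" by (rule degree_add_le_max)
  then show ?thesis
    by (simp add: ad_poly_altdef[of _ ?n] scale_left_distrib sum.distrib)
qed

lemma ad_poly_smult: "ad_poly z (smult c p) x = s c (ad_poly z p x)"
  by (simp add: ad_poly_altdef[of _ "degree p"] degree_smult_le scale_sum_right)

lemma ad_poly_0 [simp]: "ad_poly z 0 x = 0"
  by (simp add: ad_poly_def)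

lemma ad_poly_zero_right [simp]: "ad_poly z p 0 = 0"
  using shifted_funpow_0[where z = z and l = 0] by (simp add: ad_poly_def)

lemma ad_poly_add_right: "ad_poly z p (x + y) = ad_poly z p x + ad_poly z p y"
  using shifted_funpow_add[where z = z and l = 0]
  by (simp add: ad_poly_def scale_right_distrib sum.distrib)

lemma ad_poly_scale_right: "ad_poly z p (s c x) = s c (ad_poly z p x)"
  using shifted_funpow_scale[where z = z and l = 0]
  by (simp add: ad_poly_def scale_sum_right mult.commute)

lemma bracket_sum_right: "b z (\<Sum>i\<in>I. f i) = (\<Sum>i\<in>I. b z (f i))"
  using shifted_funpow_sum[where z = z and l = 0 and m = 1] by simp

lemma ad_poly_pCons: "ad_poly z (pCons c p) x = s c x + b z (ad_poly z p x)"
proof -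
  have "ad_poly z (pCons c p) x =
      (\<Sum>i\<le>Suc (degree p). s (coeff (pCons c p) i) ((b z ^^ i) x))"
    by (rule ad_poly_altdef) (simp add: degree_pCons_le)
  also have "\<dots> = s c x + b z (ad_poly z p x)"
    by (simp add: sum.atMost_Suc_shift ad_poly_def bracket_sum_right bracket_scale_right
        del: sum.atMost_Suc)
  finally show ?thesis .
qed

lemma ad_poly_linear_factor: "ad_poly z [:-l, 1:] x = shifted z l x"
  by (simp add: ad_poly_pCons shifted_def)

lemma ad_poly_mult: "ad_poly z (p * q) x = ad_poly z p (ad_poly z q x)"
  by (induction p) (simp_all add: ad_poly_add ad_poly_smult ad_poly_pCons)

lemma ad_poly_monom: "ad_poly z (monom 1 m) x = (b z ^^ m) x"
  by (induction m) (simp_all add: monom_0 ad_poly_pCons monom_Suc)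

lemma cyclic_subspace_eq: "cyclic_subspace s (b z) x = range (\<lambda>p. ad_poly z p x)"
  by (auto simp: cyclic_subspace_def ad_poly_def)

lemma subspace_cyclic: "subspace (cyclic_subspace s (b z) x)"
  unfolding cyclic_subspace_eq
  by (rule subspaceI)
    (auto simp: ad_poly_add[symmetric] ad_poly_smult[symmetric] intro: range_eqI[of _ _ 0])

lemma funpow_in_cyclic: "(b z ^^ i) x \<in> cyclic_subspace s (b z) x"
  unfolding cyclic_subspace_eq by (rule range_eqI[of _ _ "monom 1 i"]) (simp add: ad_poly_monom)

text \<open>The first \<open>card B + 1\<close> iterates of \<open>ad z\<close> on \<open>x\<close>
  lie in the span of \<open>card B\<close> vectors. A linear relation between them is the
  coefficient list of the required polynomial.\<close>

lemma torsion_imp_annihilator: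
  assumes "x \<in> torsion_alg s b z"
  obtains p where "p \<noteq> 0" "ad_poly z p x = 0"
proof -
  obtain B where B: "finite B" "cyclic_subspace s (b z) x = span B"
    using assms by (auto simp: torsion_alg_def fin_dim_subspace_def)
  define v where "v i = (b z ^^ i) x" for i
  let ?n = "card B"
  have vB: "v i \<in> span B" for i
    using funpow_in_cyclic[where i = i and z = z and x = x] B(2) by (simp add: v_def)
  have "\<exists>c. (\<exists>i\<le>?n. c i \<noteq> 0) \<and> (\<Sum>i\<le>?n. s (c i) (v i)) = 0"
  \<comment> \<open>The dimension bound counts distinct vectors. If two iterates coincide, the
    relation is their difference.\<close>
  proof (cases "inj_on v {..?n}")
    case True
    then have "card (v ` {..?n}) > card B" by (simp add: card_image)
    moreover have "v ` {..?n} \<subseteq> span B" using vB by auto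
    ultimately have "dependent (v ` {..?n})"
      using independent_span_bound[OF B(1), of "v ` {..?n}"] by auto
    then obtain u where "\<exists>w\<in>v ` {..?n}. u w \<noteq> 0" "(\<Sum>w\<in>v ` {..?n}. s (u w) w) = 0"
      using dependent_finite[of "v ` {..?n}"] by auto
    then show ?thesis using True
      by (intro exI[of _ "\<lambda>i. u (v i)"]) (auto simp: sum.reindex)
  next
    case False
    then obtain i j where ij: "i \<le> ?n" "j \<le> ?n" "i \<noteq> j" "v i = v j"
      by (auto simp: inj_on_def)
    let ?c = "\<lambda>k. if k = i then 1 else if k = j then -1 else (0::'k)"
    have "(\<Sum>k\<le>?n. s (?c k) (v k)) = (\<Sum>k\<in>{i, j}. s (?c k) (v k))"
      using ij by (intro sum.mono_neutral_right) auto
    also have "\<dots> = 0" using ij by simp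
    finally show ?thesis using ij(1) by (intro exI[of _ ?c]) auto
  qed
  then obtain c k where c: "k \<le> ?n" "c k \<noteq> 0" "(\<Sum>i\<le>?n. s (c i) (v i)) = 0" by auto
  define p where "p = (\<Sum>i\<le>?n. monom (c i) i)"
  have cp: "coeff p i = (if i \<le> ?n then c i else 0)" for i
    by (simp add: p_def coeff_sum)
  have "degree p \<le> ?n" by (rule degree_le) (simp add: cp)
  then have "ad_poly z p x = 0" using c(3) by (simp add: ad_poly_altdef cp v_def)
  moreover have "p \<noteq> 0" using c(1,2) cp[of k] by auto
  ultimately show ?thesis using that by blast
qed

text \<open>Once the leading coefficient is inverted, \<open>p\<close> is a linear recurrence that
  expresses each iterate of index at least \<open>degree p\<close> through the
  \<open>degree p\<close> iterates before it.\<close>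

lemma annihilator_imp_torsion:
  assumes "p \<noteq> 0" "ad_poly z p x = 0"
  shows "x \<in> torsion_alg s b z"
proof -
  define v where "v i = (b z ^^ i) x" for i
  let ?d = "degree p" let ?U = "span (v ` {..<?d})"
  have v: "v i \<in> ?U" for i
  proof (induction i rule: less_induct)
    case (less i)
    show ?case
    proof (cases "i < ?d")
      case True
      then show ?thesis by (intro span_base) auto
    next
      case False
      then obtain e where i: "i = e + ?d" by (metis le_add_diff_inverse2 not_less)
      \<comment> \<open>Applying \<open>ad z\<close> another \<open>e\<close> times shifts the
        relation so that its top term is \<open>v i\<close>.\<close>
      have "(b z ^^ e) (ad_poly z p x) = (\<Sum>j\<le>?d. s (coeff p j) (v (e + j)))"
        by (simp add: ad_poly_def v_def funpow_add shifted_funpow_sum[where l = 0, simplified]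
            shifted_funpow_scale[where l = 0, simplified])
      also have "\<dots> = (\<Sum>j<?d. s (coeff p j) (v (e + j))) + s (lead_coeff p) (v i)"
        by (simp add: i lessThan_Suc_atMost[symmetric])
      finally have "s (lead_coeff p) (v i) = - (\<Sum>j<?d. s (coeff p j) (v (e + j)))"
        using assms(2) shifted_funpow_0[where z = z and l = 0] by (simp add: eq_neg_iff_add_eq_0 add.commute)
      also have "\<dots> \<in> ?U"
        using less i by (intro span_neg span_sum span_scale) auto
      finally have "s (inverse (lead_coeff p)) (s (lead_coeff p) (v i)) \<in> ?U"
        by (rule span_scale)
      then show ?thesis using assms(1) by simp
    qed
  qed
  have "cyclic_subspace s (b z) x \<subseteq> ?U"
    using v by (auto simp: cyclic_subspace_def v_def intro!: span_sum span_scale)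
  moreover have "?U \<subseteq> cyclic_subspace s (b z) x"
    by (intro span_minimal subspace_cyclic) (auto simp: v_def funpow_in_cyclic)
  ultimately show ?thesis
    by (auto simp: torsion_alg_def fin_dim_subspace_def intro!: exI[of _ "v ` {..<?d}"])
qed

lemma torsion_iff: "x \<in> torsion_alg s b z \<longleftrightarrow> (\<exists>p. p \<noteq> 0 \<and> ad_poly z p x = 0)"
  using torsion_imp_annihilator annihilator_imp_torsion by metis

lemma subspace_torsion_alg: "subspace (torsion_alg s b z)"
proof (rule subspaceI)
  show "0 \<in> torsion_alg s b z" by (auto simp: torsion_iff intro!: exI[of _ 1])
next
  fix x y assume "x \<in> torsion_alg s b z" "y \<in> torsion_alg s b z"
  then obtain p q where pq: "p \<noteq> 0" "ad_poly z p x = 0" "q \<noteq> 0" "ad_poly z q y = 0"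
    by (auto simp: torsion_iff)
  have "ad_poly z (p * q) (x + y) = ad_poly z (q * p) x + ad_poly z (p * q) y"
    by (simp add: ad_poly_add_right mult.commute)
  then have "ad_poly z (p * q) (x + y) = 0" using pq(2,4) by (simp add: ad_poly_mult)
  then show "x + y \<in> torsion_alg s b z"
    unfolding torsion_iff using pq(1,3) by (intro exI[of _ "p * q"]) simp
next
  fix c x assume "x \<in> torsion_alg s b z"
  then show "s c x \<in> torsion_alg s b z" by (auto simp: torsion_iff ad_poly_scale_right)
qed

lemma nil_alg_subset_torsion: "nil_alg b z \<subseteq> torsion_alg s b z"
proof
  fix x assume "x \<in> nil_alg b z"
  then obtain m where "(b z ^^ m) x = 0" by (auto simp: nil_alg_def)
  then show "x \<in> torsion_alg s b z"
    unfolding torsion_iff by (intro exI[of _ "monom 1 m"]) (simp add: ad_poly_monom monom_eq_0_iff)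
qed

lemma eigen_alg_subset_torsion: "eigen_alg s b z \<subseteq> torsion_alg s b z"
  unfolding eigen_alg_def
proof (intro span_minimal subspace_torsion_alg subsetI)
  fix x assume "x \<in> (\<Union>l\<in>Ev s b z. eigenspace s b z l)"
  then obtain l where "x \<in> eigenspace s b z l" by auto
  then show "x \<in> torsion_alg s b z"
    unfolding torsion_iff
    by (intro exI[of _ "[:-l, 1:]"]) (simp add: ad_poly_linear_factor eigenspace_iff)
qed

lemma eigen_alg_eq_centralizer:
  assumes "Ev s b z = {0}"
  shows "eigen_alg s b z = centralizer b z"
proof -
  have "subspace (eigenspace s b z 0)"
    by (rule subspaceI) (auto simp: eigenspace_def bracket_add_right bracket_scale_right)
  then show ?thesis
    using assms by (simp add: eigen_alg_def span_eq_iff) (simp add: eigenspace_def centralizer_def)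
qed

text \<open>Absence of Jordan blocks of size two, the sense in which \<open>ad z\<close> is semisimple on its
  torsion.\<close>

definition ad_semisimple :: "'a \<Rightarrow> bool" where
  "ad_semisimple z \<longleftrightarrow> (\<forall>l x. shifted z l (shifted z l x) = 0 \<longrightarrow> shifted z l x = 0)"

text \<open>An \<open>x\<close> killed by the square of \<open>shifted z l\<close> is torsion, hence
  a sum of eigenvectors. By independence the square kills each component separately, so those for
  eigenvalues other than \<open>l\<close> are zero.\<close>

lemma eigen_eq_torsion_imp_semisimple:
  assumes "eigen_alg s b z = torsion_alg s b z"
  shows "ad_semisimple z"
  unfolding ad_semisimple_def
proof (intro allI impI)
  fix l x assume x: "shifted z l (shifted z l x) = 0"
  then have "ad_poly z ([:-l, 1:] * [:-l, 1:]) x = 0"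
    by (simp only: ad_poly_mult ad_poly_linear_factor)
  then have "x \<in> eigen_alg s b z"
    unfolding assms by (intro annihilator_imp_torsion) auto
  then obtain M g where g: "finite M" "\<And>l. g l \<in> eigenspace s b z l" "x = (\<Sum>l\<in>M. g l)"
    using eigen_alg_iff by auto
  have gen: "g k \<in> gen_eigenspace z k" for k using g(2) eigenspace_subset_gen by blast
  have "(\<Sum>k\<in>M. (shifted z l ^^ 2) (g k)) = (shifted z l ^^ 2) x"
    by (simp only: g(3) shifted_funpow_sum)
  also have "\<dots> = 0" using x by (simp add: numeral_2_eq_2)
  finally have 0: "(shifted z l ^^ 2) (g k) = 0" if "k \<in> M" for k
    using gen_eigenspaces_independent[OF g(1), of "\<lambda>k. k" "\<lambda>k. (shifted z l ^^ 2) (g k)" z k]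
      gen_eigenspace_funpow[OF gen] that by (auto simp: inj_on_def)
  have "shifted z l (g k) = 0" if "k \<in> M" for k
  proof (cases "k = l")
    case True
    then show ?thesis using g(2)[of k] by (simp add: eigenspace_iff)
  next
    case False
    then have "g k = 0" using shifted_funpow_eq_0_imp[OF 0[OF that] gen] by blast
    then show ?thesis by simp
  qed
  then show "shifted z l x = 0" using shifted_funpow_sum[where z = z and l = l and m = 1 and f = g and I = M] by (simp add: g(3))
qed

end

section \<open>Algebraically closed scalars: torsion by induction on linear factors\<close>

locale nc_poisson_algebra_closed = nc_poisson_algebra s b
  for s :: "'k::alg_closed_field \<Rightarrow> 'a::ring_1 \<Rightarrow> 'a" and b
begin

text \<open>A root \<open>a\<close> of an annihilator of \<open>x\<close> can be divided out,
  leaving an annihilator of \<open>shifted z a x\<close> of smaller degree. A nonzero constant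
  annihilates only \<open>0\<close>, which is the base case.\<close>

lemma torsion_induct [consumes 1, case_names zero step]:
  assumes "x \<in> torsion_alg s b z" "Q 0" "\<And>l x. Q (shifted z l x) \<Longrightarrow> Q x"
  shows "Q x"
proof -
  obtain p where "p \<noteq> 0" "ad_poly z p x = 0" using assms(1) torsion_iff by auto
  then show ?thesis
  proof (induction "degree p" arbitrary: p x rule: less_induct)
    case less
    show ?case
    proof (cases "degree p = 0")
      case True
      then obtain c where "p = [:c:]" by (rule degree_eq_zeroE)
      then have "x = 0" using less.prems by (simp add: ad_poly_pCons)
      then show ?thesis using assms(2) by simp
    next
      case False
      then obtain a where "poly p a = 0" using alg_closed_imp_poly_has_root[of p] by auto
      then obtain q where q: "p = [:-a, 1:] * q" by (auto simp: poly_eq_0_iff_dvd elim: dvdE)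
      then have "q \<noteq> 0" using less.prems(1) by auto
      then have deg: "degree q < degree p" unfolding q by (subst degree_mult_eq) auto
      have "ad_poly z q (shifted z a x) = ad_poly z (q * [:-a, 1:]) x"
        by (simp only: ad_poly_mult ad_poly_linear_factor)
      also have "\<dots> = 0" using less.prems(2) q by (simp only: mult.commute)
      finally have "Q (shifted z a x)" using less.hyps[OF deg \<open>q \<noteq> 0\<close>] by blast
      then show ?thesis by (rule assms(3))
    qed
  qed
qed

text \<open>Going back through one factor \<open>shifted z l\<close>: for \<open>l = 0\<close> the
  nilpotency exponent grows by one; for \<open>l\<close> nonzero, \<open>(b z ^^ m) x\<close>
  satisfies the eigenvector equation for \<open>l\<close> and vanishes because \<open>l\<close> is
  no eigenvalue.\<close>

lemma torsion_eq_nil_alg: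
  assumes "Ev s b z = {0}"
  shows "torsion_alg s b z = nil_alg b z"
proof
  show "torsion_alg s b z \<subseteq> nil_alg b z"
  proof
    fix x assume "x \<in> torsion_alg s b z"
    then show "x \<in> nil_alg b z"
    proof (induction rule: torsion_induct)
      case zero
      show ?case by (auto simp: nil_alg_def intro: exI[of _ 0])
    next
      case (step l x)
      then obtain m where m: "(b z ^^ m) (shifted z l x) = 0" by (auto simp: nil_alg_def)
      show ?case
      proof (cases "l = 0")
        case True
        then have "(b z ^^ Suc m) x = 0" using m by (simp add: funpow_swap1)
        then show ?thesis unfolding nil_alg_def by blast
      next
        case False
        have "shifted z l ((b z ^^ m) x) = 0"
          using m shifted_funpow_commute[of m z 0 1 l x] by simp
        then have "(b z ^^ m) x = 0" using assms False by (auto simp: Ev_def shifted_def)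
        then show ?thesis unfolding nil_alg_def by blast
      qed
    qed
  qed
qed (rule nil_alg_subset_torsion)

lemma eigen_eq_torsion_iff: "eigen_alg s b z = torsion_alg s b z \<longleftrightarrow> ad_semisimple z"
proof
  assume ss: "ad_semisimple z"
  have "torsion_alg s b z \<subseteq> eigen_alg s b z"
  proof
    fix x assume "x \<in> torsion_alg s b z"
    then show "x \<in> eigen_alg s b z"
    proof (induction rule: torsion_induct)
      case zero
      show ?case using subspace_eigen_alg by (rule subspace_0)
    next
      case (step l x)
      then obtain M g where g: "finite M" "\<And>k. g k \<in> eigenspace s b z k"
        "\<And>k. k \<notin> M \<Longrightarrow> g k = 0" "shifted z l x = (\<Sum>k\<in>M. g k)"
        using eigen_alg_iff by auto
      \<comment> \<open>\<open>shifted z l\<close> multiplies the component at \<open>k\<close> by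
        \<open>k - l\<close>. Dividing by that factor makes \<open>w\<close> a preimage of
        everything in \<open>shifted z l x\<close> except the component at \<open>l\<close>.\<close>
      define w where "w = (\<Sum>k\<in>M - {l}. s (inverse (k - l)) (g k))"
      have "shifted z l (s (inverse (k - l)) (g k)) = g k" if "k \<noteq> l" for k
        using g(2)[of k] that
        by (simp add: shifted_scale) (simp add: eigenspace_def shifted_def flip: scale_left_diff_distrib)
      then have "shifted z l w = (\<Sum>k\<in>M - {l}. g k)"
        by (simp add: w_def shifted_funpow_sum[where m = 1, simplified])
      moreover have "shifted z l x = g l + (\<Sum>k\<in>M - {l}. g k)"
        using g(1,3,4) by (cases "l \<in> M") (auto simp: sum.remove)
      moreover have "x = (x - w) + w" by simp
      ultimately have "shifted z l (x - w) = g l" by (metis shifted_add add_right_cancel)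
      \<comment> \<open>What remains could only be a Jordan block at \<open>l\<close>;
        semisimplicity makes it an eigenvector or zero.\<close>
      then have "shifted z l (shifted z l (x - w)) = 0"
        using g(2)[of l] by (simp add: eigenspace_iff)
      then have "shifted z l (x - w) = 0" using ss by (auto simp: ad_semisimple_def)
      then have "x - w \<in> eigen_alg s b z"
        using eigenspace_subset_eigen_alg eigenspace_iff by blast
      moreover have "w \<in> eigen_alg s b z"
        unfolding w_def using g(2) eigenspace_subset_eigen_alg
        by (intro subspace_sum subspace_scale subspace_eigen_alg) blast
      ultimately show ?case using subspace_add[OF subspace_eigen_alg, of "x - w" z w] by simp
    qed
  qed
  then show "eigen_alg s b z = torsion_alg s b z" using eigen_alg_subset_torsion by blast
qed (rule eigen_eq_torsion_imp_semisimple)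

end


section \<open>Linear independence of powers\<close>

context nc_poisson_algebra
begin

lemma shifted_funpow_eigenvector_mult:
  assumes "shifted z l w = 0"
  shows "(shifted z (l + k) ^^ n) (w * u) = w * (shifted z k ^^ n) u"
  by (induction n) (auto simp: shifted_mult assms)

text \<open>The Leibniz expansion stops after two terms: \<open>y\<close> can fall to
  \<open>w\<close> in any of \<open>Suc n\<close> positions, and a second fall gives
  \<open>0\<close>.\<close>

lemma shifted_funpow_jordan_mult:
  assumes "shifted z l y = w" "shifted z l w = 0"
  shows "(shifted z (l + k) ^^ Suc n) (y * u) =
    y * (shifted z k ^^ Suc n) u + s (of_nat (Suc n)) (w * (shifted z k ^^ n) u)"
proof (induction n)
  case 0
  show ?case by (simp add: shifted_mult assms)
next
  case (Suc n)
  have "s 2 v = v + v" for v by (metis one_add_one scale_left_distrib scale_one)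
  then show ?case
    unfolding funpow.simps(2)[of "Suc n" "shifted z (l + k)"] comp_apply Suc
    by (simp add: shifted_add shifted_scale shifted_mult assms scale_left_distrib add.assoc)
qed

text \<open>Terms in which some factor \<open>y\<close> is hit twice vanish. With \<open>n\<close>
  applications each factor is hit exactly once, in one of \<open>n!\<close> orders; one more
  application must hit some factor twice. Both claims go through one induction, since the step for
  the first uses the second as well.\<close>

lemma shifted_funpow_power:
  assumes "shifted z l y = w" "shifted z l w = 0"
  shows "(shifted z (of_nat n * l) ^^ n) (y ^ n) = s (of_nat (fact n)) (w ^ n)"
    and "(shifted z (of_nat n * l) ^^ Suc n) (y ^ n) = 0"
proof -
  have "(shifted z (of_nat n * l) ^^ n) (y ^ n) = s (of_nat (fact n)) (w ^ n) \<and>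
    (shifted z (of_nat n * l) ^^ Suc n) (y ^ n) = 0"
  proof (induction n)
    case 0
    show ?case by simp
  next
    case (Suc n)
    have eq: "of_nat (Suc n) * l = l + of_nat n * l" by (simp add: algebra_simps)
    have 1: "(shifted z (l + of_nat n * l) ^^ Suc n) (y * y ^ n) = s (of_nat (fact (Suc n))) (w * w ^ n)"
      unfolding shifted_funpow_jordan_mult[OF assms] using Suc
      by (simp add: scale_mult_right algebra_simps del: funpow.simps)
    have 2: "(shifted z (of_nat n * l) ^^ Suc (Suc n)) (y ^ n) = 0"
      using shifted_funpow_mono[OF conjunct2[OF Suc], of "Suc (Suc n)"] by (simp only: le_SucI)
    have "(shifted z (l + of_nat n * l) ^^ Suc (Suc n)) (y * y ^ n) = 0"
      unfolding shifted_funpow_jordan_mult[OF assms] conjunct2[OF Suc] 2 by simp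
    with 1 show ?case unfolding eq power_Suc by blast
  qed
  then show "(shifted z (of_nat n * l) ^^ n) (y ^ n) = s (of_nat (fact n)) (w ^ n)"
    and "(shifted z (of_nat n * l) ^^ Suc n) (y ^ n) = 0" by auto
qed

lemma eigenspace_power:
  assumes "y \<in> eigenspace s b z l"
  shows "y ^ n \<in> eigenspace s b z (of_nat n * l)"
proof (induction n)
  case 0
  show ?case by (simp add: eigenspace_def)
next
  case (Suc n)
  show ?case using eigenspace_mult[OF assms Suc] by (simp add: algebra_simps)
qed

definition powers_independent :: "'a set \<Rightarrow> 'a \<Rightarrow> bool" where
  "powers_independent A y \<longleftrightarrow>
    (\<forall>n f. (\<forall>i\<le>n. f i \<in> A) \<longrightarrow> (\<Sum>i\<le>n. f i * y ^ i) = 0 \<longrightarrow> (\<forall>i\<le>n. f i = 0))"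

lemma powers_independent_mono:
  "powers_independent B y \<Longrightarrow> A \<subseteq> B \<Longrightarrow> powers_independent A y"
  unfolding powers_independent_def by (meson subsetD)

lemma powers_independentD:
  "powers_independent A y \<Longrightarrow> (\<And>i. i \<le> n \<Longrightarrow> f i \<in> A) \<Longrightarrow> (\<Sum>i\<le>n. f i * y ^ i) = 0 \<Longrightarrow>
    i \<le> n \<Longrightarrow> f i = 0"
  unfolding powers_independent_def by blast

end

locale nc_poisson_domain = nc_poisson_algebra_closed s b
  for s :: "'k::{alg_closed_field, field_char_0} \<Rightarrow> 'a::ring_1_no_zero_divisors \<Rightarrow> 'a" and b
begin

text \<open>Multiplication by an element of \<open>N z\<close> does not change the generalized
  eigenvalue, so the summand with exponent \<open>i\<close> belongs to \<open>of_nat i * l\<close>.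
  These are distinct in characteristic zero; so every summand vanishes, and in a domain
  \<open>y ^ i\<close> cancels.\<close>

lemma powers_independent_eigenvector:
  assumes "y \<in> eigenspace s b z l" "l \<noteq> 0" "y \<noteq> 0"
  shows "powers_independent (nil_alg b z) y"
  unfolding powers_independent_def
proof (intro allI impI)
  fix n f i
  assume f: "\<forall>i\<le>n. f i \<in> nil_alg b z" "(\<Sum>i\<le>n. f i * y ^ i) = 0" and i: "i \<le> n"
  have "f i * y ^ i \<in> gen_eigenspace z (of_nat i * l)" if "i \<le> n" for i
    using gen_eigenspace_mult[of "f i" z 0 "y ^ i" "of_nat i * l"] that f(1)
      eigenspace_power[OF assms(1), of i] eigenspace_subset_gen
    by (auto simp: nil_alg_eq)
  then have "f i * y ^ i = 0"
    using gen_eigenspaces_independent[of "{..n}" "\<lambda>i. of_nat i * l" "\<lambda>i. f i * y ^ i" z i]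
      f(2) i assms(2) by (auto simp: inj_on_def)
  then show "f i = 0" using assms(3) by simp
qed

text \<open>All summands here share the generalized eigenvalue \<open>\<nu>\<close>, so they are
  separated by height instead. The \<open>n\<close>-th power of \<open>shifted z \<nu>\<close> kills
  the exponents below \<open>n\<close> and turns the top summand into \<open>n!\<close> times
  \<open>e n * w ^ n\<close>. This forces \<open>e n = 0\<close> in a domain of characteristic zero,
  and the induction descends.\<close>

lemma homogeneous_powers_independent:
  assumes y: "shifted z l y = w" "shifted z l w = 0" "w \<noteq> 0"
    and "\<And>i. i \<le> n \<Longrightarrow> e i \<in> eigenspace s b z (\<nu> - of_nat i * l)"
    and "(\<Sum>i\<le>n. e i * y ^ i) = 0" "i \<le> n"
  shows "e i = 0"
  using assms(4-6)
proof (induction n arbitrary: i)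
  case 0
  then show ?case by simp
next
  case (Suc n)
  let ?n = "Suc n"
  have T: "(shifted z \<nu> ^^ m) (e i * y ^ i) = e i * (shifted z (of_nat i * l) ^^ m) (y ^ i)"
    if "i \<le> ?n" for i m
    using shifted_funpow_eigenvector_mult[of z "\<nu> - of_nat i * l" "e i" m "of_nat i * l" "y ^ i"]
      Suc.prems(1)[OF that] by (simp add: eigenspace_iff)
  have 0: "(shifted z \<nu> ^^ ?n) (e i * y ^ i) = 0" if "i \<le> n" for i
  proof -
    have "(shifted z (of_nat i * l) ^^ ?n) (y ^ i) = 0"
      by (rule shifted_funpow_mono[OF shifted_funpow_power(2)[OF y(1,2)]]) (use that in simp)
    then show ?thesis using that by (simp add: T del: funpow.simps)
  qed
  have "(\<Sum>i\<le>?n. (shifted z \<nu> ^^ ?n) (e i * y ^ i)) = 0"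
    using arg_cong[OF Suc.prems(2), of "shifted z \<nu> ^^ ?n"]
    by (simp only: shifted_funpow_sum shifted_funpow_0)
  then have "(shifted z \<nu> ^^ ?n) (e ?n * y ^ ?n) = 0"
    using 0 by (simp del: funpow.simps power_Suc)
  then have "s (of_nat (fact ?n)) (e ?n * w ^ ?n) = 0"
    using shifted_funpow_power(1)[OF y(1,2), of ?n]
    by (simp add: T scale_mult_right del: funpow.simps power_Suc fact_Suc of_nat_Suc)
  then have "e ?n = 0" using y(3) by (simp del: fact_Suc)
  then show ?case
    using Suc.IH[of i] Suc.prems by (cases "i = ?n") auto
qed

text \<open>Split every coefficient into eigencomponents and collect the terms by total eigenvalue.
  The groups vanish separately since they lie in different generalized eigenspaces; inside a group
  the heights of the powers decide.\<close>

lemma powers_independent_jordan: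
  assumes y: "shifted z l y = w" "shifted z l w = 0" "w \<noteq> 0"
  shows "powers_independent (eigen_alg s b z) y"
  unfolding powers_independent_def
proof (intro allI impI)
  fix n f i
  assume f: "\<forall>i\<le>n. f i \<in> eigen_alg s b z" "(\<Sum>i\<le>n. f i * y ^ i) = 0" and i: "i \<le> n"
  have "\<forall>i\<in>{..n}. \<exists>M g. finite M \<and> (\<forall>l. g l \<in> eigenspace s b z l) \<and>
      (\<forall>l. l \<notin> M \<longrightarrow> g l = 0) \<and> f i = (\<Sum>l\<in>M. g l)"
    using f(1) unfolding eigen_alg_iff by blast
  then obtain M g where g: "\<And>i. i \<le> n \<Longrightarrow> finite (M i)"
    "\<And>i k. i \<le> n \<Longrightarrow> g i k \<in> eigenspace s b z k"
    "\<And>i k. i \<le> n \<Longrightarrow> k \<notin> M i \<Longrightarrow> g i k = 0" "\<And>i. i \<le> n \<Longrightarrow> f i = (\<Sum>k\<in>M i. g i k)"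
    by (metis atMost_iff)
  \<comment> \<open>\<open>k + of_nat i * l\<close> is the total eigenvalue of the term
    \<open>g i k * y ^ i\<close>.\<close>
  define N where "N = (\<Union>i\<le>n. (\<lambda>k. k + of_nat i * l) ` M i)"
  have fin: "finite N" using g(1) by (auto simp: N_def)
  have fN: "f i = (\<Sum>\<nu>\<in>N. g i (\<nu> - of_nat i * l))" if "i \<le> n" for i
  proof -
    let ?h = "\<lambda>\<nu>. \<nu> - of_nat i * l"
    \<comment> \<open>Reindexing by total eigenvalue may introduce components outside
      \<open>M i\<close>, but these are zero.\<close>
    have "M i \<subseteq> ?h ` N" using that by (force simp: N_def)
    then have "f i = (\<Sum>k\<in>?h ` N. g i k)"
      unfolding g(4)[OF that] using g(3)[OF that] fin by (intro sum.mono_neutral_left) auto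
    also have "\<dots> = (\<Sum>\<nu>\<in>N. g i (?h \<nu>))" by (subst sum.reindex) (auto simp: inj_on_def)
    finally show ?thesis .
  qed
  define h where "h \<nu> = (\<Sum>i\<le>n. g i (\<nu> - of_nat i * l) * y ^ i)" for \<nu>
  have "(\<Sum>\<nu>\<in>N. h \<nu>) = (\<Sum>i\<le>n. f i * y ^ i)"
    unfolding h_def by (subst sum.swap) (simp add: fN sum_distrib_right)
  then have sum0: "(\<Sum>\<nu>\<in>N. h \<nu>) = 0" using f(2) by simp
  have ypow: "y ^ i \<in> gen_eigenspace z (of_nat i * l)" for i
    using shifted_funpow_power(2)[OF y(1,2), of i] unfolding gen_eigenspace_def by blast
  have hgen: "h \<nu> \<in> gen_eigenspace z \<nu>" for \<nu>
    unfolding h_def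
  proof (intro subspace_sum subspace_gen_eigenspace)
    fix i assume "i \<in> {..n}"
    then have "g i (\<nu> - of_nat i * l) \<in> gen_eigenspace z (\<nu> - of_nat i * l)"
      using g(2)[of i "\<nu> - of_nat i * l"] eigenspace_subset_gen by (auto dest: subsetD)
    from gen_eigenspace_mult[OF this ypow[of i]]
    show "g i (\<nu> - of_nat i * l) * y ^ i \<in> gen_eigenspace z \<nu>" by simp
  qed
  have "g i (\<nu> - of_nat i * l) = 0" if "\<nu> \<in> N" for \<nu>
  proof -
    have "h \<nu> = 0"
      using gen_eigenspaces_independent[OF fin, of "\<lambda>\<nu>. \<nu>" h z \<nu>] hgen sum0 that
      by (simp add: inj_on_def)
    then show ?thesis
      using homogeneous_powers_independent[OF y, of n "\<lambda>i. g i (\<nu> - of_nat i * l)" \<nu> i] g(2) i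
      by (simp add: h_def)
  qed
  then show "f i = 0" using fN[OF i] by simp
qed

end

section \<open>Growth of filtrations and Gelfand-Kirillov dimension\<close>

text \<open>A factor \<open>n\<close> adds exactly one to a logarithm in base \<open>n\<close>.
  Replacing base \<open>n\<close> by base \<open>2 * n\<close> costs the factor
  \<open>ln (2 * n) / ln n\<close>, which tends to \<open>1\<close>, and the limit superior along
  the even numbers is at most the full one.\<close>

lemma limsup_log_add_one_le:
  fixes a c :: "nat \<Rightarrow> nat"
  assumes "\<And>n. a n > 0" "\<And>n. n * a n \<le> c (2 * n)"
  shows "limsup (\<lambda>n. ereal (log (real n) (real (a n)))) + 1
    \<le> limsup (\<lambda>n. ereal (log (real n) (real (c n))))"
proof -
  let ?u = "\<lambda>n. ereal (log (real n) (real (c n)))"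
  let ?r = "\<lambda>n::nat. 2 * n"
  let ?q = "\<lambda>n. ereal (ln (2 * real n) / ln (real n))"
  have "limsup (\<lambda>n. ereal (log (real n) (real (a n)))) + 1
      = limsup (\<lambda>n. 1 + ereal (log (real n) (real (a n))))"
    by (subst ereal_limsup_lim_add[of _ 1]) (auto simp: add.commute)
  also have "\<dots> \<le> limsup (\<lambda>n. ?q n * (?u \<circ> ?r) n)"
  proof (rule Limsup_mono)
    show "\<forall>\<^sub>F n in sequentially. 1 + ereal (log (real n) (real (a n))) \<le> ?q n * (?u \<circ> ?r) n"
      \<comment> \<open>From \<open>n = 2\<close> on the base exceeds \<open>1\<close>, so that the
        logarithm is monotone.\<close>
      using eventually_ge_at_top[of 2]
    proof eventually_elim
      case (elim n)
      have "1 + log n (a n) = log n (real n * real (a n))"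
        using elim assms(1)[of n] by (simp add: log_mult)
      also have "\<dots> \<le> log n (c (2 * n))"
        using elim assms(1)[of n] assms(2)[of n] by (intro log_mono) (auto simp flip: of_nat_mult)
      also have "\<dots> = ln (2 * real n) / ln n * log (2 * n) (c (2 * n))"
        using elim by (simp add: log_def)
      finally show ?case by (simp add: one_ereal_def)
    qed
  qed
  also have "\<dots> = 1 * limsup (?u \<circ> ?r)"
  proof (rule ereal_limsup_lim_mult)
    have "filterlim (\<lambda>n::nat. ln (real n)) at_infinity sequentially"
      by (rule filterlim_at_top_imp_at_infinity)
        (rule filterlim_compose[OF ln_at_top filterlim_real_sequentially])
    then have "(\<lambda>n::nat. 1 + ln 2 / ln (real n)) \<longlonglongrightarrow> 1 + 0"
      by (intro tendsto_add tendsto_const tendsto_divide_0[OF tendsto_const])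
    moreover have "\<forall>\<^sub>F n::nat in sequentially. 1 + ln 2 / ln (real n) = ln (2 * real n) / ln (real n)"
      using eventually_ge_at_top[of 2]
      by eventually_elim (simp add: ln_mult add_divide_distrib)
    ultimately have "(\<lambda>n::nat. ln (2 * real n) / ln (real n)) \<longlonglongrightarrow> 1"
      using Lim_transform_eventually by fastforce
    then show "?q \<longlonglongrightarrow> 1" by (simp add: one_ereal_def)
  qed auto
  also have "\<dots> \<le> limsup ?u" by (simp add: limsup_subseq_mono strict_mono_def)
  finally show ?thesis .
qed


text \<open>Stated for families, since the products to be counted are indexed by pairs; independence
  itself makes the family injective, two equal members giving a nontrivial relation. The finite
  \<open>T\<close> guarantees a finite basis, which matters because an infinite one has
  \<open>card\<close> equal to \<open>0\<close>.\<close>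

lemma (in vector_space) card_family_le_dim:
  assumes "finite I" "finite T" "U = span T" "f ` I \<subseteq> U"
    and indep: "\<And>c i. (\<Sum>i\<in>I. scale (c i) (f i)) = 0 \<Longrightarrow> i \<in> I \<Longrightarrow> c i = 0"
  shows "card I \<le> dim U"
proof -
  have inj: "inj_on f I"
  proof (rule inj_onI, rule ccontr)
    fix i j assume ij: "i \<in> I" "j \<in> I" "f i = f j" "i \<noteq> j"
    let ?c = "\<lambda>k. if k = i then 1 else if k = j then -1 else (0::'a)"
    have "(\<Sum>k\<in>I. scale (?c k) (f k)) = (\<Sum>k\<in>{i, j}. scale (?c k) (f k))"
      using ij assms(1) by (intro sum.mono_neutral_right) auto
    also have "\<dots> = 0" using ij by simp
    finally show False using indep[of ?c i] ij(1) by simp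
  qed
  have ind: "independent (f ` I)"
  proof (rule independent_if_scalars_zero)
    fix c x assume "(\<Sum>x\<in>f ` I. scale (c x) x) = 0" "x \<in> f ` I"
    then show "c x = 0" using indep[of "\<lambda>i. c (f i)"] inj by (auto simp: sum.reindex)
  qed (use assms(1) in simp)
  obtain B where B: "B \<subseteq> U" "independent B" "U \<subseteq> span B" "card B = dim U"
    by (rule basis_exists)
  have "finite B" using independent_span_bound[OF assms(2) B(2)] B(1) assms(3) by simp
  then have "card (f ` I) \<le> card B" using independent_span_bound[OF _ ind] B(3) assms(4) by blast
  then show ?thesis using inj B(4) by (simp add: card_image)
qed

context nc_poisson_algebra
begin

lemma span_products:
  "span {x * y | x y. x \<in> span A \<and> y \<in> span B} = span {x * y | x y. x \<in> A \<and> y \<in> B}"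
  (is "_ = ?U")
proof
  show "span {x * y | x y. x \<in> span A \<and> y \<in> span B} \<subseteq> ?U"
  proof (rule span_minimal)
    have 1: "x * y \<in> ?U" if "x \<in> A" "y \<in> span B" for x y
      using that(2)
    proof (induction rule: span_induct_alt)
      case (step c v w)
      have "x * v \<in> ?U" using that(1) step(1) by (intro span_base) blast
      then show ?case using step(2)
        by (simp add: distrib_left scale_mult_right span_add span_scale)
    qed (simp add: span_zero)
    have "x * y \<in> ?U" if "x \<in> span A" "y \<in> span B" for x y
      using that(1)
    proof (induction rule: span_induct_alt)
      case (step c v w)
      then show ?case using 1 that(2)
        by (simp add: distrib_right scale_mult_left span_add span_scale)
    qed (simp add: span_zero)
    then show "{x * y | x y. x \<in> span A \<and> y \<in> span B} \<subseteq> ?U" by blast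
  qed simp
  show "?U \<subseteq> span {x * y | x y. x \<in> span A \<and> y \<in> span B}"
    by (rule span_mono) (blast intro: span_base)
qed

lemma fin_dim_subspace_power:
  assumes "fin_dim_subspace s V"
  shows "fin_dim_subspace s (subspace_power s V n)"
proof (induction n)
  case 0
  show ?case unfolding fin_dim_subspace_def by (intro exI[of _ "{1}"]) simp
next
  case (Suc n)
  obtain A B where AB: "finite A" "subspace_power s V n = span A" "finite B" "V = span B"
    using Suc assms by (auto simp: fin_dim_subspace_def)
  have "finite {x * y | x y. x \<in> A \<and> y \<in> B}" using AB(1,3) by (simp add: finite_image_set2)
  then show ?case unfolding fin_dim_subspace_def using span_products[of A B] AB by auto
qed

lemma fin_dim_filtration:
  assumes "fin_dim_subspace s V"
  shows "fin_dim_subspace s (filtration s V n)"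
proof -
  obtain B where B: "\<And>i. finite (B i)" "\<And>i. subspace_power s V i = span (B i)"
    using fin_dim_subspace_power[OF assms] unfolding fin_dim_subspace_def by metis
  have "span (\<Union>i\<le>n. span (B i)) \<subseteq> span (\<Union>i\<le>n. B i)"
    by (intro span_minimal UN_least span_mono subspace_span) auto
  moreover have "span (\<Union>i\<le>n. B i) \<subseteq> span (\<Union>i\<le>n. span (B i))"
    by (intro span_mono UN_mono span_superset) auto
  ultimately have "filtration s V n = span (\<Union>i\<le>n. B i)"
    unfolding filtration_def B(2) by (rule antisym)
  then show ?thesis using B(1) unfolding fin_dim_subspace_def by blast
qed

lemma filtration_mono: "m \<le> n \<Longrightarrow> filtration s V m \<subseteq> filtration s V n"
  unfolding filtration_def by (intro span_mono UN_mono) auto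

lemma one_in_filtration: "1 \<in> filtration s V n"
  unfolding filtration_def by (rule span_base) (auto intro!: bexI[of _ 0] span_base)

text \<open>The family consisting of \<open>1\<close> alone is independent. Positivity lets the
  logarithm of \<open>n\<close> times the dimension be split.\<close>

lemma dim_filtration_pos:
  assumes "fin_dim_subspace s V"
  shows "dim (filtration s V n) > 0"
proof -
  obtain T where "finite T" "filtration s V n = span T"
    using fin_dim_filtration[OF assms] by (auto simp: fin_dim_subspace_def)
  then have "card {1::nat} \<le> dim (filtration s V n)"
    using one_in_filtration by (intro card_family_le_dim[where f = "\<lambda>_. 1"]) auto
  then show ?thesis by simp
qed

lemma filtration_subset:
  assumes "subspace A" "1 \<in> A" "\<And>x y. x \<in> A \<Longrightarrow> y \<in> A \<Longrightarrow> x * y \<in> A" "V \<subseteq> A"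
  shows "filtration s V n \<subseteq> A"
proof -
  have "subspace_power s V i \<subseteq> A" for i
  proof (induction i)
    case 0
    show ?case unfolding subspace_power.simps by (rule span_minimal) (use assms(1,2) in auto)
  next
    case (Suc i)
    then show ?case unfolding subspace_power.simps
      by (intro span_minimal) (use assms in auto)
  qed
  then show ?thesis unfolding filtration_def using assms(1) by (intro span_minimal) auto
qed

lemma subspace_power_mult_power:
  assumes "y \<in> W" "x \<in> subspace_power s W m"
  shows "x * y ^ i \<in> subspace_power s W (m + i)"
proof (induction i)
  case 0
  show ?case using assms(2) by simp
next
  case (Suc i)
  have "x * y ^ i * y \<in> subspace_power s W (Suc (m + i))"
    using Suc assms(1) by (auto intro!: span_base)
  then show ?case by (simp add: power_Suc2 mult.assoc del: power_Suc)
qed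

lemma filtration_mult_power:
  assumes "y \<in> W" "x \<in> filtration s W m"
  shows "x * y ^ i \<in> filtration s W (m + i)"
  using assms(2) unfolding filtration_def[of _ _ m]
proof (induction rule: span_induct_alt)
  case base
  show ?case by (simp add: filtration_def span_zero)
next
  case (step c v w)
  then obtain j where "j \<le> m" "v \<in> subspace_power s W j" by auto
  then have "v * y ^ i \<in> (\<Union>k\<le>m + i. subspace_power s W k)"
    using subspace_power_mult_power[OF assms(1), of v j i] by (intro UN_I[of "j + i"]) auto
  then show ?case using step(2) unfolding filtration_def distrib_right scale_mult_left
    by (intro span_add span_scale) (auto intro: span_base)
qed

end

section \<open>The eight types as combinations of three conditions\<close>

context nc_poisson_algebra_closed
begin

lemma eigen_psubset_torsion_iff: "eigen_alg s b z \<subset> torsion_alg s b z \<longleftrightarrow> \<not> ad_semisimple z"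
  using eigen_alg_subset_torsion[of z] eigen_eq_torsion_iff[of z] by auto

text \<open>If \<open>Ev z = {0}\<close>, then \<open>C z = D z\<close> and
  \<open>N z = F z\<close>, so all eight definitions can be read in terms of \<open>D z\<close> and
  \<open>F z\<close>. Equality of these two is semisimplicity.\<close>

lemma Omega_iff:
  "z \<in> Omega0 s b \<longleftrightarrow> Ev s b z = {0} \<and> ad_semisimple z \<and> torsion_alg s b z = UNIV"
  "z \<in> Omega0' s b \<longleftrightarrow> Ev s b z = {0} \<and> ad_semisimple z \<and> torsion_alg s b z \<noteq> UNIV"
  "z \<in> Omega1 s b \<longleftrightarrow> Ev s b z = {0} \<and> \<not> ad_semisimple z \<and> torsion_alg s b z = UNIV"
  "z \<in> Omega1' s b \<longleftrightarrow> Ev s b z = {0} \<and> \<not> ad_semisimple z \<and> torsion_alg s b z \<noteq> UNIV"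
  "z \<in> Omega2 s b \<longleftrightarrow> Ev s b z \<noteq> {0} \<and> ad_semisimple z \<and> torsion_alg s b z = UNIV"
  "z \<in> Omega2' s b \<longleftrightarrow> Ev s b z \<noteq> {0} \<and> ad_semisimple z \<and> torsion_alg s b z \<noteq> UNIV"
  "z \<in> Omega3 s b \<longleftrightarrow> Ev s b z \<noteq> {0} \<and> \<not> ad_semisimple z \<and> torsion_alg s b z = UNIV"
  "z \<in> Omega3' s b \<longleftrightarrow> Ev s b z \<noteq> {0} \<and> \<not> ad_semisimple z \<and> torsion_alg s b z \<noteq> UNIV"
proof -
  have C: "centralizer b z = eigen_alg s b z" "nil_alg b z = torsion_alg s b z"
    if "Ev s b z = {0}"
    using that eigen_alg_eq_centralizer torsion_eq_nil_alg by auto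
  have E: "{0} \<subset> Ev s b z \<longleftrightarrow> Ev s b z \<noteq> {0}" using zero_in_Ev[of z] by auto
  have F: "torsion_alg s b z \<subset> UNIV \<longleftrightarrow> torsion_alg s b z \<noteq> UNIV" by auto
  \<comment> \<open>\<open>Omega0\<close> does not mention the torsion algebra; that it is
    everything follows from \<open>D z\<close> being contained in \<open>F z\<close>.\<close>
  have U: "eigen_alg s b z = UNIV \<longleftrightarrow> eigen_alg s b z = torsion_alg s b z \<and> torsion_alg s b z = UNIV"
    using eigen_alg_subset_torsion[of z] by auto
  note S = eigen_eq_torsion_iff[of z] eigen_psubset_torsion_iff[of z]
  show "z \<in> Omega0 s b \<longleftrightarrow> Ev s b z = {0} \<and> ad_semisimple z \<and> torsion_alg s b z = UNIV"
    unfolding Omega0_def mem_Collect_eq by (metis C(1) U S(1))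
  show "z \<in> Omega0' s b \<longleftrightarrow> Ev s b z = {0} \<and> ad_semisimple z \<and> torsion_alg s b z \<noteq> UNIV"
    unfolding Omega0'_def mem_Collect_eq F by (metis C(1) S(1))
  show "z \<in> Omega1 s b \<longleftrightarrow> Ev s b z = {0} \<and> \<not> ad_semisimple z \<and> torsion_alg s b z = UNIV"
    unfolding Omega1_def mem_Collect_eq by (metis C S(2))
  show "z \<in> Omega1' s b \<longleftrightarrow> Ev s b z = {0} \<and> \<not> ad_semisimple z \<and> torsion_alg s b z \<noteq> UNIV"
    unfolding Omega1'_def mem_Collect_eq by (metis C S(2) F)
  show "z \<in> Omega2 s b \<longleftrightarrow> Ev s b z \<noteq> {0} \<and> ad_semisimple z \<and> torsion_alg s b z = UNIV"
    unfolding Omega2_def mem_Collect_eq E S by (rule refl)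
  show "z \<in> Omega2' s b \<longleftrightarrow> Ev s b z \<noteq> {0} \<and> ad_semisimple z \<and> torsion_alg s b z \<noteq> UNIV"
    unfolding Omega2'_def mem_Collect_eq E S F by (rule refl)
  show "z \<in> Omega3 s b \<longleftrightarrow> Ev s b z \<noteq> {0} \<and> \<not> ad_semisimple z \<and> torsion_alg s b z = UNIV"
    unfolding Omega3_def mem_Collect_eq E S by (rule refl)
  show "z \<in> Omega3' s b \<longleftrightarrow> Ev s b z \<noteq> {0} \<and> \<not> ad_semisimple z \<and> torsion_alg s b z \<noteq> UNIV"
    unfolding Omega3'_def mem_Collect_eq E S F by (rule refl)
qed

end

section \<open>Transfer along an injective Poisson homomorphism\<close>

locale poisson_embedding = P: nc_poisson_domain s b + Q: nc_poisson_domain s1 b1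
  for s :: "'k::{alg_closed_field, field_char_0} \<Rightarrow> 'a::ring_1_no_zero_divisors \<Rightarrow> 'a" and b
    and s1 :: "'k \<Rightarrow> 'c::ring_1_no_zero_divisors \<Rightarrow> 'c" and b1 +
  fixes \<phi> :: "'a \<Rightarrow> 'c"
  assumes hom: "poisson_hom s b s1 b1 \<phi>" and inj: "inj \<phi>"
begin

sublocale \<phi>: module_hom s s1 \<phi>
  using hom by (simp add: poisson_hom_def Vector_Spaces.linear_def)

lemma hom_one [simp]: "\<phi> 1 = 1"
  and hom_mult: "\<phi> (x * y) = \<phi> x * \<phi> y"
  and hom_bracket: "\<phi> (b x y) = b1 (\<phi> x) (\<phi> y)"
  using hom by (auto simp: poisson_hom_def)

lemma hom_eq_0_iff [simp]: "\<phi> x = 0 \<longleftrightarrow> x = 0"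
  using inj by (metis \<phi>.zero injD)

lemma hom_shifted: "\<phi> (P.shifted z l x) = Q.shifted (\<phi> z) l (\<phi> x)"
  by (simp add: P.shifted_def Q.shifted_def \<phi>.diff \<phi>.scale hom_bracket)

lemma hom_ad_poly: "\<phi> (P.ad_poly z p x) = Q.ad_poly (\<phi> z) p (\<phi> x)"
  by (induction p) (simp_all add: P.ad_poly_pCons Q.ad_poly_pCons \<phi>.add \<phi>.scale hom_bracket)

lemma Ev_subset: "Ev s b z \<subseteq> Ev s1 b1 (\<phi> z)"
  by (auto simp: Ev_def) (metis hom_bracket \<phi>.scale hom_eq_0_iff)

text \<open>By injectivity \<open>x\<close> and \<open>\<phi> x\<close> have the same annihilating
  polynomials.\<close>

lemma hom_in_torsion_iff: "\<phi> x \<in> torsion_alg s1 b1 (\<phi> z) \<longleftrightarrow> x \<in> torsion_alg s b z"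
  by (simp add: P.torsion_iff Q.torsion_iff flip: hom_ad_poly)

text \<open>A Jordan block of size two for \<open>z\<close> is carried to one for
  \<open>\<phi> z\<close>, injectivity keeping it from degenerating.\<close>

lemma ad_semisimple_reflect: "Q.ad_semisimple (\<phi> z) \<Longrightarrow> P.ad_semisimple z"
  unfolding P.ad_semisimple_def Q.ad_semisimple_def by (metis hom_shifted hom_eq_0_iff)

lemma hom_in_nil_alg:
  assumes "x \<in> nil_alg b z"
  shows "\<phi> x \<in> nil_alg b1 (\<phi> z)"
proof -
  have "\<phi> ((b z ^^ m) x) = (b1 (\<phi> z) ^^ m) (\<phi> x)" for m
    by (induction m) (simp_all add: hom_bracket)
  moreover obtain m where "(b z ^^ m) x = 0" using assms by (auto simp: nil_alg_def)
  ultimately have "(b1 (\<phi> z) ^^ m) (\<phi> x) = 0" by (metis \<phi>.zero)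
  then show ?thesis by (auto simp: nil_alg_def)
qed

lemma hom_in_eigen_alg:
  assumes "x \<in> eigen_alg s b z"
  shows "\<phi> x \<in> eigen_alg s1 b1 (\<phi> z)"
proof -
  obtain M g where g: "\<And>l. g l \<in> eigenspace s b z l" "x = (\<Sum>l\<in>M. g l)"
    using assms P.eigen_alg_iff by auto
  have "\<phi> (g l) \<in> eigenspace s1 b1 (\<phi> z) l" for l
    using g(1)[of l] by (simp add: P.eigenspace_iff Q.eigenspace_iff flip: hom_shifted)
  then show ?thesis unfolding g(2) \<phi>.sum
    using Q.eigenspace_subset_eigen_alg by (intro Q.subspace_sum Q.subspace_eigen_alg) blast
qed

lemma hom_filtration:
  assumes "\<phi> ` V \<subseteq> W"
  shows "\<phi> ` filtration s V n \<subseteq> filtration s1 W n"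
proof -
  have 1: "\<phi> ` subspace_power s V i \<subseteq> subspace_power s1 W i" for i
  proof (induction i)
    case 0
    show ?case by (simp flip: \<phi>.span_image)
  next
    case (Suc i)
    have "\<phi> ` {x * y | x y. x \<in> subspace_power s V i \<and> y \<in> V}
        \<subseteq> {x * y | x y. x \<in> subspace_power s1 W i \<and> y \<in> W}"
      using Suc assms hom_mult by blast
    then show ?case unfolding subspace_power.simps \<phi>.span_image[symmetric]
      by (rule Q.span_mono)
  qed
  show ?thesis unfolding filtration_def \<phi>.span_image[symmetric]
    by (rule Q.span_mono) (use 1 in \<open>auto simp: image_UN\<close>)
qed

text \<open>If \<open>v\<close> runs through a basis of the \<open>n\<close>-th filtration piece of
  \<open>V\<close> and \<open>i\<close> through \<open>{..n}\<close>, the products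
  \<open>\<phi> v * y ^ i\<close> are independent and have degree at most \<open>2 * n\<close>.
  There are \<open>n + 1\<close> exponents; the bound keeps only \<open>n\<close>.\<close>

lemma dim_filtration_adjoin:
  assumes A: "P.subspace A" "1 \<in> A" "\<And>x y. x \<in> A \<Longrightarrow> y \<in> A \<Longrightarrow> x * y \<in> A"
    and y: "Q.powers_independent (\<phi> ` A) y"
    and V: "fin_dim_subspace s V" "V \<subseteq> A"
    and W: "fin_dim_subspace s1 W" "\<phi> ` V \<subseteq> W" "y \<in> W"
  shows "n * P.dim (filtration s V n) \<le> Q.dim (filtration s1 W (2 * n))"
proof -
  obtain T where T: "finite T" "filtration s V n = P.span T"
    using P.fin_dim_filtration[OF V(1)] by (auto simp: fin_dim_subspace_def)
  obtain T' where T': "finite T'" "filtration s1 W (2 * n) = Q.span T'"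
    using Q.fin_dim_filtration[OF W(1)] by (auto simp: fin_dim_subspace_def)
  obtain B where B: "B \<subseteq> filtration s V n" "P.independent B" "filtration s V n \<subseteq> P.span B"
    "card B = P.dim (filtration s V n)"
    by (rule P.basis_exists)
  have finB: "finite B" using P.independent_span_bound[OF T(1) B(2)] B(1) T(2) by simp
  have BA: "B \<subseteq> A" using P.filtration_subset[OF A V(2)] B(1) by blast
  let ?I = "{..n} \<times> B" and ?f = "\<lambda>(i, v). \<phi> v * y ^ i"
  have "card ?I \<le> Q.dim (filtration s1 W (2 * n))"
  proof (rule Q.card_family_le_dim[OF _ T', where f = ?f])
    show "finite ?I" using finB by simp
    show "?f ` ?I \<subseteq> filtration s1 W (2 * n)"
    proof (rule image_subsetI)
      fix k assume "k \<in> ?I"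
      then obtain i v where k: "k = (i, v)" and iv: "i \<le> n" "v \<in> B" by auto
      have "\<phi> v \<in> filtration s1 W n" using hom_filtration[OF W(2)] B(1) iv(2) by blast
      \<comment> \<open>Placing \<open>\<phi> v\<close> in degree \<open>2 * n - i\<close> makes its
        product with \<open>y ^ i\<close> land in degree \<open>2 * n\<close>.\<close>
      moreover have "n \<le> 2 * n - i" using iv(1) by simp
      ultimately have "\<phi> v \<in> filtration s1 W (2 * n - i)"
        using Q.filtration_mono by blast
      from Q.filtration_mult_power[OF W(3) this, of i]
      show "?f k \<in> filtration s1 W (2 * n)" using k iv(1) by simp
    qed
    fix c k assume c: "(\<Sum>k\<in>?I. s1 (c k) (?f k)) = 0" and k: "k \<in> ?I"
    \<comment> \<open>Collecting equal powers of \<open>y\<close> gives coefficients that come from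
      \<open>A\<close>. They vanish by independence of the powers, and then the scalars do by
      independence of \<open>B\<close>.\<close>
    define a where "a i = (\<Sum>v\<in>B. s (c (i, v)) v)" for i
    have "(\<Sum>i\<le>n. \<phi> (a i) * y ^ i) = (\<Sum>k\<in>?I. s1 (c k) (?f k))"
      by (simp add: a_def \<phi>.sum \<phi>.scale sum_distrib_right Q.scale_mult_left
          sum.cartesian_product case_prod_unfold)
    moreover have "a i \<in> A" for i
      unfolding a_def using BA by (intro P.subspace_sum P.subspace_scale A(1)) auto
    ultimately have "\<phi> (a (fst k)) = 0"
      using Q.powers_independentD[OF y, of n "\<lambda>i. \<phi> (a i)" "fst k"] c k by auto
    then show "c k = 0"
      using P.independentD[OF B(2) finB, of "\<lambda>v. c (fst k, v)" "snd k"] k by (auto simp: a_def)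
  qed
  then show ?thesis by (simp add: card_cartesian_product B(4))
qed

text \<open>Adjoining \<open>y\<close> to the image of a generating space \<open>V\<close> raises
  its growth exponent by at least one; the supremum over \<open>V\<close> inherits this.\<close>

lemma GKdim_add_one_le:
  assumes A: "P.subspace A" "1 \<in> A" "\<And>x y. x \<in> A \<Longrightarrow> y \<in> A \<Longrightarrow> x * y \<in> A"
    and y: "Q.powers_independent (\<phi> ` A) y"
  shows "GKdim s A + 1 \<le> GKdim s1 UNIV"
proof -
  have "limsup (\<lambda>n. ereal (log (real n) (real (P.dim (filtration s V n))))) + 1 \<le> GKdim s1 UNIV"
    if V: "fin_dim_subspace s V" "V \<subseteq> A" for V
  proof -
    obtain B where B: "finite B" "V = P.span B" using V(1) by (auto simp: fin_dim_subspace_def)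
    define W where "W = Q.span (insert y (\<phi> ` B))"
    have W: "fin_dim_subspace s1 W" "\<phi> ` V \<subseteq> W" "y \<in> W"
      unfolding W_def B(2) fin_dim_subspace_def \<phi>.span_image[symmetric]
      using B(1) by (auto intro: Q.span_base subsetD[OF Q.span_mono, rotated]
          intro!: exI[of _ "insert y (\<phi> ` B)"])
    have "limsup (\<lambda>n. ereal (log (real n) (real (P.dim (filtration s V n))))) + 1
        \<le> limsup (\<lambda>n. ereal (log (real n) (real (Q.dim (filtration s1 W n)))))"
      by (intro limsup_log_add_one_le P.dim_filtration_pos dim_filtration_adjoin[OF A y] V W)
    also have "\<dots> \<le> GKdim s1 UNIV"
      unfolding GKdim_def by (rule SUP_upper) (use W(1) in simp)
    finally show ?thesis .
  qed
  \<comment> \<open>Moving the finite \<open>1\<close> to the right is legitimate in the extended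
    reals and yields a bound on each member of the supremum.\<close>
  then have "GKdim s A \<le> GKdim s1 UNIV - 1"
    unfolding GKdim_def[of s] by (intro SUP_least) (auto simp: ereal_le_minus)
  then show ?thesis by (simp add: ereal_le_minus)
qed

text \<open>Since \<open>Ev z = {0}\<close>, the nilpotent part \<open>N z\<close> is all of
  \<open>F z\<close>. A nonzero eigenvalue of \<open>\<phi> z\<close> would push the dimension of
  the target up to that of \<open>F z\<close> plus one.\<close>

lemma Ev_hom_eq_0:
  assumes "GKdim s1 UNIV < GKdim s (torsion_alg s b z) + 1" "Ev s b z = {0}"
  shows "Ev s1 b1 (\<phi> z) = {0}"
proof (rule ccontr)
  assume "Ev s1 b1 (\<phi> z) \<noteq> {0}"
  then obtain l where "l \<in> Ev s1 b1 (\<phi> z)" "l \<noteq> 0" using Q.zero_in_Ev[of "\<phi> z"] by blast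
  then obtain y where y: "y \<in> eigenspace s1 b1 (\<phi> z) l" "l \<noteq> 0" "y \<noteq> 0"
    by (auto simp: Ev_def eigenspace_def)
  let ?N = "nil_alg b z"
  have "Q.powers_independent (\<phi> ` ?N) y"
    by (rule Q.powers_independent_mono[OF Q.powers_independent_eigenvector[OF y]])
      (auto intro: hom_in_nil_alg)
  moreover have "1 \<in> ?N" by (auto simp: nil_alg_def intro!: exI[of _ 1])
  moreover have "x * y \<in> ?N" if "x \<in> ?N" "y \<in> ?N" for x y
    using P.gen_eigenspace_mult[of x z 0 y 0] that by (simp add: P.nil_alg_eq)
  ultimately have "GKdim s ?N + 1 \<le> GKdim s1 UNIV"
    by (intro GKdim_add_one_le) (auto simp: P.nil_alg_eq P.subspace_gen_eigenspace)
  then show False using assms P.torsion_eq_nil_alg by simp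
qed

text \<open>The same argument with \<open>D z\<close> in place of \<open>N z\<close>: semisimplicity
  gives \<open>D z = F z\<close>, and a Jordan block of \<open>\<phi> z\<close> supplies the element
  with independent powers.\<close>

lemma ad_semisimple_hom:
  assumes "GKdim s1 UNIV < GKdim s (torsion_alg s b z) + 1" "P.ad_semisimple z"
  shows "Q.ad_semisimple (\<phi> z)"
  unfolding Q.ad_semisimple_def
proof (intro allI impI, rule ccontr)
  fix l y assume "Q.shifted (\<phi> z) l (Q.shifted (\<phi> z) l y) = 0" "Q.shifted (\<phi> z) l y \<noteq> 0"
  then have "Q.powers_independent (\<phi> ` eigen_alg s b z) y"
    by (intro Q.powers_independent_mono[OF Q.powers_independent_jordan[OF refl]])
      (auto intro: hom_in_eigen_alg)
  then have "GKdim s (eigen_alg s b z) + 1 \<le> GKdim s1 UNIV"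
    by (intro GKdim_add_one_le P.subspace_eigen_alg P.one_in_eigen_alg P.eigen_alg_mult)
  then show False using assms P.eigen_eq_torsion_iff[of z] by simp
qed

end

theorem theorem3p8:
  fixes s :: "'k::{alg_closed_field,field_char_0} \<Rightarrow> 'a::ring_1_no_zero_divisors \<Rightarrow> 'a"
    and b :: "'a \<Rightarrow> 'a \<Rightarrow> 'a"
    and s1 :: "'k \<Rightarrow> 'c::ring_1_no_zero_divisors \<Rightarrow> 'c"
    and b1 :: "'c \<Rightarrow> 'c \<Rightarrow> 'c"
    and \<phi> :: "'a \<Rightarrow> 'c"
  assumes "nc_poisson_algebra s b"
    and "nc_poisson_algebra s1 b1"
    and "poisson_hom s b s1 b1 \<phi>"
    and "inj \<phi>"
    and "GKdim s1 (UNIV :: 'c set) < GKdim s (UNIV :: 'a set) + 1"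
    and "GKdim s (UNIV :: 'a set) + 1 < \<infinity>"
  shows
    "\<phi> ` Omega0 s b \<subseteq> Omega0 s1 b1 \<union> Omega0' s1 b1 \<and>
     \<phi> ` Omega1 s b \<subseteq> Omega1 s1 b1 \<union> Omega1' s1 b1 \<and>
     \<phi> ` Omega2 s b \<subseteq> Omega2 s1 b1 \<union> Omega2' s1 b1 \<and>
     \<phi> ` Omega3 s b \<subseteq> Omega3 s1 b1 \<union> Omega3' s1 b1 \<and>
     \<phi> ` Omega3' s b \<subseteq> Omega3' s1 b1 \<and>
     (\<phi> ` Omega' s b \<subseteq> Omega' s1 b1 \<and> \<phi> ` Omega' s b \<inter> Omega s1 b1 = {}) \<and>
     (\<forall>z. GKdim s (torsion_alg s b z) = GKdim s (UNIV :: 'a set) \<longrightarrow>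
        (z \<in> Omega1' s b \<longrightarrow> \<phi> z \<in> Omega1' s1 b1) \<and>
        (z \<in> Omega2' s b \<longrightarrow> \<phi> z \<in> Omega2' s1 b1))"
proof -
  interpret poisson_embedding s b s1 b1 \<phi>
    using assms(1-4) by (intro poisson_embedding.intro nc_poisson_domain.intro
        nc_poisson_algebra_closed.intro poisson_embedding_axioms.intro)
  have Ev: "Ev s b z = {0}" if "Ev s1 b1 (\<phi> z) = {0}" for z
    using Ev_subset[of z] that P.zero_in_Ev[of z] by auto
  have tors: "torsion_alg s b z = UNIV" if "torsion_alg s1 b1 (\<phi> z) = UNIV" for z
    using hom_in_torsion_iff[of _ z] that by auto
  \<comment> \<open>The condition on dimensions is trivial when \<open>F z\<close> is everything, so
    these facts serve the unprimed types as well as the two primed ones with a dimension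
    assumption.\<close>
  have full: "Ev s b z = {0} \<Longrightarrow> Ev s1 b1 (\<phi> z) = {0}"
    "P.ad_semisimple z \<Longrightarrow> Q.ad_semisimple (\<phi> z)"
    if "GKdim s (torsion_alg s b z) = GKdim s UNIV" for z
    using that assms(5) Ev_hom_eq_0 ad_semisimple_hom by auto
  note defs = P.Omega_iff Q.Omega_iff Omega_def Omega'_def
  show ?thesis
  proof (intro conjI allI impI)
    show "\<phi> ` Omega0 s b \<subseteq> Omega0 s1 b1 \<union> Omega0' s1 b1"
      using full by (auto simp: defs)
    show "\<phi> ` Omega1 s b \<subseteq> Omega1 s1 b1 \<union> Omega1' s1 b1"
      using full(1) ad_semisimple_reflect by (auto simp: defs)
    show "\<phi> ` Omega2 s b \<subseteq> Omega2 s1 b1 \<union> Omega2' s1 b1"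
      using full(2) Ev by (auto simp: defs)
    show "\<phi> ` Omega3 s b \<subseteq> Omega3 s1 b1 \<union> Omega3' s1 b1"
      using Ev ad_semisimple_reflect by (auto simp: defs)
    show "\<phi> ` Omega3' s b \<subseteq> Omega3' s1 b1"
      using Ev ad_semisimple_reflect tors by (auto simp: defs)
    \<comment> \<open>In the unions the first two conditions cancel out: only whether
      \<open>F z\<close> is everything distinguishes \<open>Omega\<close> from
      \<open>Omega'\<close>.\<close>
    have 1: "z \<in> Omega' s b \<longleftrightarrow> torsion_alg s b z \<noteq> UNIV" for z by (auto simp: defs)
    have 2: "w \<in> Omega' s1 b1 \<longleftrightarrow> torsion_alg s1 b1 w \<noteq> UNIV"
      "w \<in> Omega s1 b1 \<longleftrightarrow> torsion_alg s1 b1 w = UNIV" for w by (auto simp: defs)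
    show "\<phi> ` Omega' s b \<subseteq> Omega' s1 b1" using tors by (auto simp: 1 2)
    show "\<phi> ` Omega' s b \<inter> Omega s1 b1 = {}" using tors by (auto simp: 1 2)
  next
    fix z assume GK: "GKdim s (torsion_alg s b z) = GKdim s UNIV"
    show "\<phi> z \<in> Omega1' s1 b1" if "z \<in> Omega1' s b"
      using that full(1)[OF GK] ad_semisimple_reflect tors by (auto simp: defs)
    show "\<phi> z \<in> Omega2' s1 b1" if "z \<in> Omega2' s b"
      using that full(2)[OF GK] Ev tors by (auto simp: defs)
  qed
qed

end
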